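(* Let $\mathcal{A}(z)$, $A(k)$, $\lambda_A^j$, $\mathcal{P}_{\mathcal{A}}$ and its normalized irreducible factors $\mathcal{P}^1_{\mathcal{A}},\dots,\mathcal{P}^K_{\mathcal{A}}$ be as in the context. Let $\alpha\in\mathbb{R}^d$ with $\alpha\neq 0_d \bmod \mathbb{Z}^d$. Then: (1) $\mathcal{P}_{\mathcal{A}}(z,\lambda)$ satisfies condition $C_\alpha$ if and only if the set $$S_1(\alpha)=\{k\in\mathbb{R}^d:\ \text{there exist } s,w\in\{1,\dots,Q\} \text{ such that } \lambda_A^s(k+\alpha)=\lambda_A^w(k)\}$$ has Lebesgue measure zero; (2) $\mathcal{P}_{\mathcal{A}}(z,\lambda)$ is square-free if and only if the set $$S_2=\{k\in\mathbb{R}^d:\ \text{there exist distinct } s,w\in\{1,\dots,Q\} \text{ such that } \lambda_A^s(k)=\lambda_A^w(k)\}$$ has Lebesgue measure zero.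
   Context: Let $d,Q\ge1$ and $\mathbb{C}^\star=\mathbb{C}\setminus\{0\}$. Let $\mathcal{A}(z)$ be a $Q\times Q$ matrix each of whose entries is a Laurent polynomial in $z=(z_1,\dots,z_d)\in(\mathbb{C}^\star)^d$ with complex coefficients. Set $A(k)=\mathcal{A}(z)$ with $z_j=e^{2\pi i k_j}$, $k\in\mathbb{R}^d$, and assume $A(k)$ is Hermitian for every $k\in\mathbb{R}^d$. Denote by $\lambda_A^1(k)\le\lambda_A^2(k)\le\cdots\le\lambda_A^Q(k)$ the eigenvalues of $A(k)$ in non-decreasing order (spectral band functions). For $\eta,\zeta\in\mathbb{C}^d$ let $\eta\odot\zeta=(\eta_1\zeta_1,\dots,\eta_d\zeta_d)$; $0_d=(0,\dots,0)$, $1_d=(1,\dots,1)$. Let $\mathcal{P}_{\mathcal{A}}(z,\lambda)=\det(\mathcal{A}(z)-\lambda I_{Q\times Q})$, a Laurent polynomial in $z$ and polynomial in $\lambda$, and write $\mathcal{P}_{\mathcal{A}}(z,\lambda)=(-1)^Q\prod_{l=1}^K\mathcal{P}^l_{\mathcal{A}}(z,\lambda)$ where each $\mathcal{P}^l_{\mathcal{A}}$ is a non-monomial irreducible factor (in the ring of Laurent polynomials in $z$, polynomials in $\lambda$), normalized so that it is a Laurent polynomial in $z$, a polynomial in $\lambda$, and its coefficient of the highest power of $\lambda$ equals $1$ (factors repeated with multiplicity). $\mathcal{P}_{\mathcal{A}}$ is called square-free if $\mathcal{P}^{l_1}_{\mathcal{A}}\not\equiv\mathcal{P}^{l_2}_{\mathcal{A}}$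 for all distinct $l_1,l_2\in\{1,\dots,K\}$. For $\alpha\in\mathbb{R}^d$ with $\alpha\ne0_d\bmod\mathbb{Z}^d$, set $\zeta=(e^{2\pi i\alpha_1},\dots,e^{2\pi i\alpha_d})$; $\mathcal{P}_{\mathcal{A}}$ satisfies condition $C_\alpha$ if for all $l_1,l_2\in\{1,\dots,K\}$ (possibly equal), $\mathcal{P}^{l_1}_{\mathcal{A}}(z,\lambda)\not\equiv\mathcal{P}^{l_2}_{\mathcal{A}}(\zeta\odot z,\lambda)$. *)

theory Defs
  imports "HOL-Analysis.Analysis" "HOL-Library.Poly_Mapping" "HOL-Library.Product_Plus"
    "HOL-Computational_Algebra.Computational_Algebra"
begin

type_synonym 'd lpoly = "(int ^ 'd) \<Rightarrow>\<^sub>0 complex"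

text \<open>Laurent polynomials in z that are polynomials in lambda: the exponent
  (m, n) stands for the monomial z^m lambda^n.  Multiplication is convolution,
  so this is the ring C[z_1^{+-1},...,z_d^{+-1}][lambda].\<close>
type_synonym 'd lpolyl = "((int ^ 'd) \<times> nat) \<Rightarrow>\<^sub>0 complex"

definition dotk :: "int ^ 'd \<Rightarrow> real ^ 'd \<Rightarrow> real" where
  "dotk m k = (\<Sum>j\<in>UNIV. of_int (m $ j) * k $ j)"

definition eval_torus :: "'d::finite lpoly \<Rightarrow> real ^ 'd \<Rightarrow> complex" where
  "eval_torus p k = (\<Sum>m\<in>Poly_Mapping.keys p.
      Poly_Mapping.lookup p m * exp (2 * pi * \<i> * complex_of_real (dotk m k)))"

definition symb :: "('q \<Rightarrow> 'q \<Rightarrow> 'd::finite lpoly) \<Rightarrow> real ^ 'd \<Rightarrow> complex ^ 'q ^ 'q" where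
  "symb A k = (\<chi> i j. eval_torus (A i j) k)"

definition hermitian_mat :: "complex ^ 'q ^ 'q \<Rightarrow> bool" where
  "hermitian_mat M \<longleftrightarrow> (\<forall>i j. M $ i $ j = cnj (M $ j $ i))"

definition charpoly :: "complex ^ 'q::finite ^ 'q \<Rightarrow> complex poly" where
  "charpoly M = det (\<chi> i j. [: M $ i $ j :] - (if i = j then [:0, 1:] else 0))"

text \<open>The eigenvalues in non-decreasing order, as a list of length Q (the
  list index j corresponds to lambda^{j+1}).\<close>
definition bands :: "complex ^ 'q::finite ^ 'q \<Rightarrow> real list" where
  "bands M = (THE ls. length ls = CARD('q) \<and> sorted ls \<and>
      charpoly M = (\<Prod>l\<leftarrow>ls. [: complex_of_real l, -1 :]))"

definition band :: "('q::finite \<Rightarrow> 'q \<Rightarrow> 'd::finite lpoly) \<Rightarrow> nat \<Rightarrow> real ^ 'd \<Rightarrow> real" where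
  "band A j k = bands (symb A k) ! j"

definition embz :: "'d::finite lpoly \<Rightarrow> 'd lpolyl" where
  "embz p = (\<Sum>m\<in>Poly_Mapping.keys p. Poly_Mapping.single (m, 0) (Poly_Mapping.lookup p m))"

definition lam :: "'d::finite lpolyl" where
  "lam = Poly_Mapping.single (0, 1) 1"

definition PA :: "('q::finite \<Rightarrow> 'q \<Rightarrow> 'd::finite lpoly) \<Rightarrow> 'd lpolyl" where
  "PA A = det (\<chi> i j. embz (A i j) - (if i = j then lam else 0))"

definition lam_degree :: "'d::finite lpolyl \<Rightarrow> nat" where
  "lam_degree P = Max (insert 0 (snd ` Poly_Mapping.keys P))"

definition lam_monic :: "'d::finite lpolyl \<Rightarrow> bool" where
  "lam_monic P \<longleftrightarrow> (\<forall>m. Poly_Mapping.lookup P (m, lam_degree P) = (if m = 0 then 1 else 0))"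

text \<open>P(zeta \<odot> z, lambda) with zeta_j = exp(2 pi i alpha_j).\<close>
definition shiftz :: "real ^ 'd::finite \<Rightarrow> 'd lpolyl \<Rightarrow> 'd lpolyl" where
  "shiftz \<alpha> P = Poly_Mapping.mapp
     (\<lambda>(m, n) c. exp (2 * pi * \<i> * complex_of_real (dotk m \<alpha>)) * c) P"

definition cond_C :: "real ^ 'd::finite \<Rightarrow> 'd lpolyl list \<Rightarrow> bool" where
  "cond_C \<alpha> Ps \<longleftrightarrow> (\<forall>l1<length Ps. \<forall>l2<length Ps. Ps ! l1 \<noteq> shiftz \<alpha> (Ps ! l2))"

definition square_free_factors :: "'d::finite lpolyl list \<Rightarrow> bool" where
  "square_free_factors Ps \<longleftrightarrow> (\<forall>l1<length Ps. \<forall>l2<length Ps. l1 \<noteq> l2 \<longrightarrow> Ps ! l1 \<noteq> Ps ! l2)"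

end

theory Submission
  imports Defs "HOL-Computational_Algebra.Field_as_Ring"
begin

text \<open>
  Restricted to a line \<open>k + t v\<close> with a generic integer direction \<open>v\<close>, a nonzero Laurent polynomial
  becomes a nonzero univariate polynomial in \<open>exp (2 \<pi> i t)\<close>; hence by Fubini its zero set on the
  torus is negligible. A coincidence of bands at \<open>k\<close> is a common root of two factors at \<open>k\<close> (one of
  them possibly shifted by \<open>\<alpha>\<close>), or a common root of a factor and its \<open>\<lambda>\<close>-derivative. If \<open>P\<close> is
  monic and irreducible and does not divide \<open>H\<close>, then \<open>U P + V H = D\<close> for some nonzero Laurent
  polynomial \<open>D\<close> in \<open>z\<close> alone, so that \<open>P\<close> and \<open>H\<close> have a common root only on the zero set of \<open>D\<close>.

  To find \<open>D\<close>, take \<open>G\<close> of least \<open>\<lambda>\<close>-degree in the ideal of \<open>P\<close> and \<open>H\<close>, with leading coefficient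
  \<open>b\<close>. It divides \<open>b\<^sup>N P\<close> and \<open>b\<^sup>N H\<close> for some \<open>N\<close>. If its degree were positive, then \<open>G / b\<close> would be
  a monic factor of \<open>P\<close> by the Gauss lemma, hence equal to \<open>P\<close>, and \<open>P\<close> would divide \<open>H\<close>. The Gauss
  lemma for Laurent polynomials in several variables is reduced to the one for \<open>\<complex>[x][\<lambda>]\<close> along the
  same generic lines, which avoids unique factorization in several variables.
\<close>

section \<open>Homomorphisms of commutative rings and their action on polynomials\<close>

locale comm_ring_hom =
  fixes h :: "'a::comm_ring_1 \<Rightarrow> 'b::comm_ring_1"
  assumes hom_one: "h 1 = 1"
    and hom_add: "h (x + y) = h x + h y"
    and hom_mult: "h (x * y) = h x * h y"
begin

lemma hom_zero: "h 0 = 0"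
  using hom_add[of 0 0] by simp

lemma hom_uminus: "h (- x) = - h x"
proof -
  have "h x + h (- x) = 0"
    by (simp add: hom_add[symmetric] hom_zero)
  then show ?thesis
    by (metis neg_eq_iff_add_eq_0)
qed

lemma hom_diff: "h (x - y) = h x - h y"
  using hom_add[of x "- y"] by (simp add: hom_uminus)

lemma hom_dvd: "x dvd y \<Longrightarrow> h x dvd h y"
  by (auto simp: hom_mult)

lemma hom_power: "h (x ^ n) = h x ^ n"
  by (induction n) (simp_all add: hom_one hom_mult)

lemma hom_sum: "h (\<Sum>i\<in>I. f i) = (\<Sum>i\<in>I. h (f i))"
  by (induction I rule: infinite_finite_induct) (simp_all add: hom_zero hom_add)

lemma hom_prod: "h (\<Prod>i\<in>I. f i) = (\<Prod>i\<in>I. h (f i))"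
  by (induction I rule: infinite_finite_induct) (simp_all add: hom_one hom_mult)

lemma hom_prod_list: "h (prod_list xs) = prod_list (map h xs)"
  by (induction xs) (simp_all add: hom_one hom_mult)

lemma hom_of_nat: "h (of_nat n) = of_nat n"
  by (induction n) (simp_all add: hom_one hom_zero hom_add)

lemma hom_of_int: "h (of_int n) = of_int n"
  by (cases n) (simp_all add: hom_of_nat hom_uminus hom_diff hom_one)

lemma hom_det: "h (det M) = det (\<chi> i j. h (M $ i $ j))"
  unfolding det_def by (simp add: hom_sum hom_mult hom_prod hom_of_int)

lemma coeff_map_hom [simp]: "coeff (map_poly h p) n = h (coeff p n)"
  by (simp add: coeff_map_poly hom_zero)

lemma map_poly_hom: "comm_ring_hom (map_poly h)"
proof
  show "map_poly h 1 = 1"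
    by (simp add: hom_one)
  show "map_poly h (p + q) = map_poly h p + map_poly h q" for p q
    by (rule poly_eqI) (simp add: hom_add)
  show "map_poly h (p * q) = map_poly h p * map_poly h q" for p q
    by (rule poly_eqI) (simp add: coeff_mult hom_sum hom_mult)
qed

lemma map_poly_hom_smult: "map_poly h (smult c p) = smult (h c) (map_poly h p)"
  by (rule poly_eqI) (simp add: hom_mult)


end

subsection \<open>Linear extension of characters to monoid algebras\<close>

lemma poly_mapping_sum_single:
  "p = (\<Sum>m\<in>Poly_Mapping.keys p. Poly_Mapping.single m (Poly_Mapping.lookup p m))"
proof (rule poly_mapping_eqI)
  fix m
  have "(\<Sum>x\<in>Poly_Mapping.keys p. if m = x then Poly_Mapping.lookup p x else 0)
      = Poly_Mapping.lookup p m"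
    by (auto simp: sum.delta' in_keys_iff)
  then show "Poly_Mapping.lookup p m = Poly_Mapping.lookup
      (\<Sum>m\<in>Poly_Mapping.keys p. Poly_Mapping.single m (Poly_Mapping.lookup p m)) m"
    by (simp add: lookup_sum lookup_single when_def eq_commute[of m])
qed

text \<open>For a ring homomorphism \<open>h\<close> and a character \<open>ch\<close> on exponents
  this is the induced homomorphism of the monoid algebra. Torus evaluation, \<open>to_poly\<close>,
  \<open>shiftz\<close> and \<open>line\<close> are all instances.\<close>

definition lin_ext ::
  "('b::comm_ring_1 \<Rightarrow> 'c::comm_ring_1) \<Rightarrow> ('a \<Rightarrow> 'c) \<Rightarrow> ('a \<Rightarrow>\<^sub>0 'b) \<Rightarrow> 'c" where
  "lin_ext h ch p = (\<Sum>m\<in>Poly_Mapping.keys p. h (Poly_Mapping.lookup p m) * ch m)"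

context comm_ring_hom
begin

lemma lin_ext_superset:
  assumes "finite S" "Poly_Mapping.keys p \<subseteq> S"
  shows "lin_ext h ch p = (\<Sum>m\<in>S. h (Poly_Mapping.lookup p m) * ch m)"
  unfolding lin_ext_def using assms
  by (intro sum.mono_neutral_left) (auto simp: in_keys_iff hom_zero)

lemma lin_ext_single: "lin_ext h ch (Poly_Mapping.single m c) = h c * ch m"
  by (subst lin_ext_superset[of "{m}"]) auto

lemma lin_ext_zero: "lin_ext h ch 0 = 0"
  by (simp add: lin_ext_def)

lemma lin_ext_add: "lin_ext h ch (p + q) = lin_ext h ch p + lin_ext h ch q"
proof -
  let ?S = "Poly_Mapping.keys p \<union> Poly_Mapping.keys q"
  have "Poly_Mapping.keys (p + q) \<subseteq> ?S"
    by (rule keys_add)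
  then show ?thesis
    by (simp add: lin_ext_superset[of ?S] lookup_add hom_add distrib_right sum.distrib)
qed

lemma lin_ext_sum: "lin_ext h ch (\<Sum>i\<in>I. f i) = (\<Sum>i\<in>I. lin_ext h ch (f i))"
  by (induction I rule: infinite_finite_induct) (simp_all add: lin_ext_zero lin_ext_add)

text \<open>Multiplicativity of \<open>ch\<close> is asked only on the supports of the two factors,
  because the exponent map behind \<open>line\<close> truncates and is not multiplicative
  everywhere.\<close>

lemma lin_ext_mult:
  assumes "\<And>a b. a \<in> Poly_Mapping.keys p \<Longrightarrow> b \<in> Poly_Mapping.keys q \<Longrightarrow> ch (a + b) = ch a * ch b"
  shows "lin_ext h ch (p * q) = lin_ext h ch p * lin_ext h ch q"
proof -
  have "p * q = (\<Sum>a\<in>Poly_Mapping.keys p. \<Sum>b\<in>Poly_Mapping.keys q.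
      Poly_Mapping.single (a + b) (Poly_Mapping.lookup p a * Poly_Mapping.lookup q b))"
    by (subst poly_mapping_sum_single[of p], subst poly_mapping_sum_single[of q])
       (simp add: sum_product mult_single)
  then have "lin_ext h ch (p * q) = (\<Sum>a\<in>Poly_Mapping.keys p. \<Sum>b\<in>Poly_Mapping.keys q.
      h (Poly_Mapping.lookup p a * Poly_Mapping.lookup q b) * ch (a + b))"
    by (simp only: lin_ext_sum lin_ext_single)
  also have "\<dots> = lin_ext h ch p * lin_ext h ch q"
    unfolding lin_ext_def sum_product by (intro sum.cong refl) (simp add: assms hom_mult mult_ac)
  finally show ?thesis .
qed

lemma lin_ext_hom:
  fixes ch :: "'c::comm_monoid_add \<Rightarrow> 'b"
  assumes "ch 0 = 1" "\<And>a b. ch (a + b) = ch a * ch b"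
  shows "comm_ring_hom (lin_ext h ch)"
proof
  show "lin_ext h ch 1 = 1"
    unfolding single_one[symmetric] lin_ext_single by (simp add: hom_one assms(1))
qed (simp_all add: lin_ext_add lin_ext_mult assms(2))

end

lemma comm_ring_hom_id: "comm_ring_hom (\<lambda>x. x)"
  by unfold_locales auto

lemma comm_ring_hom_single: "comm_ring_hom (Poly_Mapping.single 0)"
  by unfold_locales (auto simp: single_add mult_single)

lemma comm_ring_hom_compose:
  assumes "comm_ring_hom f" "comm_ring_hom g"
  shows "comm_ring_hom (\<lambda>x. f (g x))"
  using assms unfolding comm_ring_hom_def by auto

subsection \<open>Characters of the torus\<close>

definition cis_char :: "int ^ 'd::finite \<Rightarrow> real ^ 'd \<Rightarrow> complex" where
  "cis_char m k = exp (2 * pi * \<i> * complex_of_real (dotk m k))"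

lemma dotk_simps [simp]:
  "dotk 0 k = 0" "dotk m 0 = 0"
  "dotk (m + n) k = dotk m k + dotk n k" "dotk m (k + l) = dotk m k + dotk m l"
  "dotk m (- k) = - dotk m k"
  "dotk m (t *\<^sub>R k) = t * dotk m k"
  unfolding dotk_def
  by (auto simp: sum.distrib distrib_left distrib_right sum_negf sum_distrib_left mult_ac)

lemma cis_char_simps [simp]:
  "cis_char 0 k = 1" "cis_char m 0 = 1"
  "cis_char (m + n) k = cis_char m k * cis_char n k"
  "cis_char m (k + l) = cis_char m k * cis_char m l"
  by (auto simp: cis_char_def distrib_left exp_add)

lemma cis_char_nonzero [simp]: "cis_char m k \<noteq> 0"
  by (simp add: cis_char_def)

lemma eval_torus_lin_ext: "eval_torus p k = lin_ext (\<lambda>x. x) (\<lambda>m. cis_char m k) p"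
  by (simp add: eval_torus_def lin_ext_def cis_char_def)

lemma eval_torus_hom: "comm_ring_hom (\<lambda>p. eval_torus p k)"
  unfolding eval_torus_lin_ext by (rule comm_ring_hom.lin_ext_hom[OF comm_ring_hom_id]) auto

interpretation eval_torus: comm_ring_hom "\<lambda>p. eval_torus p k" for k :: "real ^ 'd::finite"
  by (rule eval_torus_hom)

lemma eval_torus_single: "eval_torus (Poly_Mapping.single m c) k = c * cis_char m k"
  unfolding eval_torus_lin_ext by (rule comm_ring_hom.lin_ext_single[OF comm_ring_hom_id])

subsection \<open>Laurent polynomials in z and lambda as polynomials in lambda\<close>

text \<open>Regrouping by powers of lambda gives univariate polynomials over the Laurent ring, where
  leading coefficients and pseudo-division are available.\<close>

definition to_poly :: "'d::finite lpolyl \<Rightarrow> 'd lpoly poly" where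
  "to_poly = lin_ext (\<lambda>c. [:Poly_Mapping.single 0 c:])
     (\<lambda>(m, n). monom (Poly_Mapping.single m 1) n)"

lemma comm_ring_hom_const_poly: "comm_ring_hom (\<lambda>c::'a::comm_ring_1. [:c:])"
  by unfold_locales (auto simp: one_pCons)

lemma to_poly_hom: "comm_ring_hom to_poly"
  unfolding to_poly_def
proof (rule comm_ring_hom.lin_ext_hom)
  show "comm_ring_hom (\<lambda>c. [:Poly_Mapping.single 0 c:])"
    by (rule comm_ring_hom_compose[OF comm_ring_hom_const_poly comm_ring_hom_single])
qed (auto simp: zero_prod_def mult_monom mult_single split: prod.splits)

interpretation to_poly: comm_ring_hom to_poly
  by (rule to_poly_hom)

lemma to_poly_single:
  "to_poly (Poly_Mapping.single (m, n) c) = monom (Poly_Mapping.single m c) n"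
  unfolding to_poly_def
  by (subst comm_ring_hom.lin_ext_single[OF comm_ring_hom_compose[OF comm_ring_hom_const_poly comm_ring_hom_single]])
     (simp add: smult_monom mult_single)

lemma lookup_to_poly:
  "Poly_Mapping.lookup (coeff (to_poly P) n) m = Poly_Mapping.lookup P (m, n)"
proof -
  have "to_poly P = (\<Sum>(a, b)\<in>Poly_Mapping.keys P.
      monom (Poly_Mapping.single a (Poly_Mapping.lookup P (a, b))) b)"
    by (subst poly_mapping_sum_single[of P], subst to_poly.hom_sum)
       (auto simp: to_poly_single intro!: sum.cong)
  also have "Poly_Mapping.lookup (coeff \<dots> n) m
      = (\<Sum>x\<in>Poly_Mapping.keys P. if x = (m, n) then Poly_Mapping.lookup P x else 0)"
    unfolding coeff_sum lookup_sum
    by (intro sum.cong refl) (auto simp: lookup_single when_def split: prod.splits)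
  also have "\<dots> = Poly_Mapping.lookup P (m, n)"
    by (auto simp: in_keys_iff)
  finally show ?thesis .
qed

lemma to_poly_eq_iff [simp]: "to_poly P = to_poly Q \<longleftrightarrow> P = Q"
proof
  assume "to_poly P = to_poly Q"
  then have "Poly_Mapping.lookup P (m, n) = Poly_Mapping.lookup Q (m, n)" for m n
    by (metis lookup_to_poly)
  then show "P = Q"
    by (intro poly_mapping_eqI) auto
qed auto

lemma to_poly_surj: "\<exists>P. to_poly P = p"
proof -
  have "to_poly (\<Sum>n\<le>degree p. \<Sum>m\<in>Poly_Mapping.keys (coeff p n).
      Poly_Mapping.single (m, n) (Poly_Mapping.lookup (coeff p n) m))
    = (\<Sum>n\<le>degree p. monom (coeff p n) n)"
  proof -
    have "(\<Sum>m\<in>Poly_Mapping.keys c. monom (Poly_Mapping.single m (Poly_Mapping.lookup c m)) n)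
      = monom c n" for c :: "'a lpoly" and n
      by (subst (3) poly_mapping_sum_single[of c]) (simp add: monom_sum)
    then show ?thesis
      by (simp add: to_poly.hom_sum to_poly_single)
  qed
  also have "\<dots> = p"
    by (rule poly_as_sum_of_monoms)
  finally show ?thesis by blast
qed

lemma to_poly_embz: "to_poly (embz p) = [:p:]"
proof -
  have "to_poly (embz p) = monom (\<Sum>m\<in>Poly_Mapping.keys p. Poly_Mapping.single m (Poly_Mapping.lookup p m)) 0"
    unfolding embz_def by (simp add: to_poly.hom_sum to_poly_single monom_sum)
  then show ?thesis
    by (simp add: poly_mapping_sum_single[symmetric] monom_0)
qed

lemma to_poly_lam: "to_poly lam = [:0, 1:]"
  unfolding lam_def by (simp add: to_poly_single monom_altdef)

lemma to_poly_dvd_iff: "to_poly P dvd to_poly Q \<longleftrightarrow> P dvd Q"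
proof
  assume "to_poly P dvd to_poly Q"
  then obtain R where "to_poly Q = to_poly P * to_poly R"
    by (metis dvdE to_poly_surj)
  then show "P dvd Q"
    by (metis dvdI to_poly.hom_mult to_poly_eq_iff)
qed (auto simp: to_poly.hom_mult)

text \<open>\<open>to_poly\<close> is a bijective homomorphism, so every factorization of the image
  pulls back.\<close>

lemma to_poly_irreducible:
  assumes "irreducible P" shows "irreducible (to_poly P)"
proof (rule irreducibleI)
  show "to_poly P \<noteq> 0"
    using assms to_poly_eq_iff[of P 0] by (auto simp: to_poly.hom_zero)
  show "\<not> to_poly P dvd 1"
    using assms to_poly_dvd_iff[of P 1] by (auto simp: to_poly.hom_one irreducible_def)
next
  fix a b assume ab: "to_poly P = a * b"
  obtain A B where AB: "a = to_poly A" "b = to_poly B"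
    by (metis to_poly_surj)
  with ab have "P = A * B"
    by (metis to_poly.hom_mult to_poly_eq_iff)
  with assms have "A dvd 1 \<or> B dvd 1"
    by (simp add: irreducible_def)
  then show "a dvd 1 \<or> b dvd 1"
    unfolding AB by (metis to_poly_dvd_iff to_poly.hom_one)
qed

lemma degree_to_poly: "degree (to_poly P) = lam_degree P"
proof (rule antisym)
  show "degree (to_poly P) \<le> lam_degree P"
  proof (rule degree_le, intro allI impI)
    fix n assume n: "lam_degree P < n"
    have "(m, n) \<notin> Poly_Mapping.keys P" for m
    proof
      assume "(m, n) \<in> Poly_Mapping.keys P"
      then have "n \<in> insert 0 (snd ` Poly_Mapping.keys P)"
        by force
      with n show False
        unfolding lam_degree_def by (meson Max_ge finite_imageI finite_insert finite_keys not_less)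
    qed
    then show "coeff (to_poly P) n = 0"
      by (intro poly_mapping_eqI) (simp add: lookup_to_poly in_keys_iff)
  qed
  have "n \<le> degree (to_poly P)" if "(m, n) \<in> Poly_Mapping.keys P" for m n
  proof (rule le_degree)
    from that have "Poly_Mapping.lookup (coeff (to_poly P) n) m \<noteq> 0"
      by (simp add: lookup_to_poly in_keys_iff)
    then show "coeff (to_poly P) n \<noteq> 0"
      by force
  qed
  then show "lam_degree P \<le> degree (to_poly P)"
    unfolding lam_degree_def by (subst Max_le_iff) auto
qed

lemma lead_coeff_to_poly:
  assumes "lam_monic P" shows "lead_coeff (to_poly P) = 1"
  using assms unfolding degree_to_poly lam_monic_def
  by (intro poly_mapping_eqI) (simp add: lookup_to_poly lookup_one when_def)

lemma shiftz_lookup: "Poly_Mapping.lookup (shiftz \<alpha> P) (m, n) = cis_char m \<alpha> * Poly_Mapping.lookup P (m, n)"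
  unfolding shiftz_def by (simp add: lookup_mapp cis_char_def when_def in_keys_iff)

text \<open>Written as a linear extension of a character, the coefficientwise twist is seen to be a
  ring homomorphism.\<close>

lemma shiftz_lin_ext:
  "shiftz \<alpha> = lin_ext (Poly_Mapping.single 0) (\<lambda>(m, n). Poly_Mapping.single (m, n) (cis_char m \<alpha>))"
proof (rule ext, rule poly_mapping_eqI, safe)
  fix P :: "'a lpolyl" and m n
  have "Poly_Mapping.lookup (lin_ext (Poly_Mapping.single 0) (\<lambda>(m, n). Poly_Mapping.single (m, n) (cis_char m \<alpha>)) P) (m, n)
     = (\<Sum>x\<in>Poly_Mapping.keys P. if x = (m, n) then cis_char m \<alpha> * Poly_Mapping.lookup P x else 0)"
    unfolding lin_ext_def lookup_sum
    by (intro sum.cong refl) (auto simp: lookup_single mult_single when_def split: prod.splits)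
  also have "\<dots> = Poly_Mapping.lookup (shiftz \<alpha> P) (m, n)"
    by (auto simp: in_keys_iff shiftz_lookup)
  finally show "Poly_Mapping.lookup (shiftz \<alpha> P) (m, n) = Poly_Mapping.lookup
      (lin_ext (Poly_Mapping.single 0) (\<lambda>(m, n). Poly_Mapping.single (m, n) (cis_char m \<alpha>)) P) (m, n)" ..
qed

lemma one_lpolyl: "Poly_Mapping.single (0, 0) 1 = (1 :: 'd::finite lpolyl)"
  unfolding zero_prod_def[symmetric] by simp

lemma shiftz_hom: "comm_ring_hom (shiftz \<alpha>)"
  unfolding shiftz_lin_ext
  by (rule comm_ring_hom.lin_ext_hom[OF comm_ring_hom_single])
     (auto simp: mult_single zero_prod_def one_lpolyl split: prod.splits)

interpretation shiftz: comm_ring_hom "shiftz \<alpha>" for \<alpha> :: "real ^ 'd::finite"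
  by (rule shiftz_hom)

lemma cis_char_uminus: "cis_char m (- \<alpha>) * cis_char m \<alpha> = 1"
  by (simp add: cis_char_simps(4)[symmetric] del: cis_char_simps(4))

lemma shiftz_uminus: "shiftz (- \<alpha>) (shiftz \<alpha> P) = P" "shiftz \<alpha> (shiftz (- \<alpha>) P) = P"
proof -
  have *: "cis_char m (- \<alpha>) * (cis_char m \<alpha> * c) = c" "cis_char m \<alpha> * (cis_char m (- \<alpha>) * c) = c" for m c
    using cis_char_uminus[of m \<alpha>] by algebra+
  show "shiftz (- \<alpha>) (shiftz \<alpha> P) = P" "shiftz \<alpha> (shiftz (- \<alpha>) P) = P"
    by (auto intro!: poly_mapping_eqI simp: shiftz_lookup *)
qed

text \<open>The shift by \<open>- \<alpha>\<close> inverts the shift by \<open>\<alpha>\<close>, so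
  twisting is a ring automorphism.\<close>

lemma shiftz_irreducible:
  assumes "irreducible P" shows "irreducible (shiftz \<alpha> P)"
proof (rule irreducibleI)
  show "shiftz \<alpha> P \<noteq> 0"
    using assms shiftz_uminus(1)[of \<alpha> P] by (auto simp: shiftz.hom_zero)
  show "\<not> shiftz \<alpha> P dvd 1"
  proof
    assume "shiftz \<alpha> P dvd 1"
    then obtain Q where "1 = shiftz \<alpha> P * Q" by blast
    then have "1 = P * shiftz (- \<alpha>) Q"
      by (metis shiftz.hom_mult shiftz.hom_one shiftz_uminus(1))
    with assms show False
      by (metis dvdI irreducible_not_unit)
  qed
next
  fix a b assume "shiftz \<alpha> P = a * b"
  then have "P = shiftz (- \<alpha>) a * shiftz (- \<alpha>) b"
    by (metis shiftz.hom_mult shiftz_uminus(1))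
  with assms have "shiftz (- \<alpha>) a dvd 1 \<or> shiftz (- \<alpha>) b dvd 1"
    by (simp add: irreducible_def)
  then show "a dvd 1 \<or> b dvd 1"
    using shiftz.hom_dvd[of "shiftz (- \<alpha>) a" 1 \<alpha>] shiftz.hom_dvd[of "shiftz (- \<alpha>) b" 1 \<alpha>]
    by (auto simp: shiftz_uminus shiftz.hom_one)
qed

lemma shiftz_monic:
  assumes "lam_monic P" shows "lam_monic (shiftz \<alpha> P)"
proof -
  have "Poly_Mapping.keys (shiftz \<alpha> P) = Poly_Mapping.keys P"
    by (auto simp: in_keys_iff shiftz_lookup)
  with assms show ?thesis
    by (auto simp: lam_monic_def lam_degree_def shiftz_lookup)
qed

text \<open>Translating the point by \<open>\<alpha>\<close> multiplies the monomial with exponent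
  \<open>m\<close> by \<open>cis_char m \<alpha>\<close>, just as the twist does to its coefficient.
  This turns bands at \<open>k + \<alpha>\<close> into roots of twisted factors at
  \<open>k\<close>.\<close>

lemma map_poly_shiftz:
  "map_poly (\<lambda>p. eval_torus p k) (to_poly (shiftz \<alpha> P)) = map_poly (\<lambda>p. eval_torus p (k + \<alpha>)) (to_poly P)"
proof (rule poly_eqI)
  fix n
  have "eval_torus c k = eval_torus d (k + \<alpha>)"
    if "\<And>m. Poly_Mapping.lookup c m = cis_char m \<alpha> * Poly_Mapping.lookup d m" for c d :: "'a lpoly"
  proof -
    have "Poly_Mapping.keys c = Poly_Mapping.keys d"
      by (auto simp: in_keys_iff that)
    then show ?thesis
      by (simp add: eval_torus_lin_ext lin_ext_def that mult_ac)
  qed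
  then show "coeff (map_poly (\<lambda>p. eval_torus p k) (to_poly (shiftz \<alpha> P))) n
      = coeff (map_poly (\<lambda>p. eval_torus p (k + \<alpha>)) (to_poly P)) n"
    by (simp add: lookup_to_poly shiftz_lookup)
qed

subsection \<open>Generic directions and restriction to lines\<close>

definition idot :: "int ^ 'd::finite \<Rightarrow> int ^ 'd \<Rightarrow> int" where
  "idot m v = (\<Sum>j\<in>UNIV. m $ j * v $ j)"

lemma idot_simps [simp]: "idot 0 v = 0" "idot (m + n) v = idot m v + idot n v"
  by (auto simp: idot_def distrib_right sum.distrib)

lemma idot_diff: "idot (m - n) v = idot m v - idot n v"
  by (auto simp: idot_def left_diff_distrib sum_subtractf)

lemma idot_axis [simp]: "idot (axis j c) v = c * v $ j"
  by (simp add: idot_def axis_def if_distrib[of "\<lambda>x. x * _"] cong: if_cong)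

text \<open>The witness consists of powers of a suitable integer, as in Kronecker substitution.\<close>
lemma generic_direction:
  fixes S :: "(int ^ 'd::finite) set"
  assumes "finite S"
  shows "\<exists>v. v $ j = 1 \<and> inj_on (\<lambda>m. idot m v) S"
proof -
  obtain f :: "'d \<Rightarrow> nat" where f: "inj f"
    using finite_imp_inj_to_nat_seg[of "UNIV :: 'd set"] by auto
  \<comment> \<open>Distinct exponents, with \<open>e j = 0\<close> so that coordinate
    \<open>j\<close> of the direction is \<open>N ^ 0 = 1\<close>.\<close>
  define e where "e i = (if i = j then 0 else Suc (f i))" for i
  have e: "e i = e i' \<longleftrightarrow> i = i'" for i i'
    using f by (auto simp: e_def inj_def)
  define p where "p u = (\<Sum>i\<in>UNIV. monom (u $ i) (e i))" for u :: "int ^ 'd"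
  have coeff: "coeff (p u) (e i) = u $ i" for u i
    by (simp add: p_def coeff_sum e)
  have p: "p u \<noteq> 0" if "u \<noteq> 0" for u
    using that coeff[of u] by (auto simp: vec_eq_iff)
  \<comment> \<open>The bad integers: roots of the polynomials whose coefficients are the entries of
    a difference of two elements of \<open>S\<close>.\<close>
  define B where "B = (\<Union>(m, n)\<in>{(m, n) \<in> S \<times> S. m \<noteq> n}. {x. poly (p (m - n)) x = 0})"
  have "finite B"
    unfolding B_def using assms p
    by (intro finite_UN_I finite_subset[OF _ finite_cartesian_product[OF assms assms]])
       (auto intro: poly_roots_finite)
  then obtain N where N: "N \<notin> B"
    using ex_new_if_finite infinite_UNIV_int by blast
  define v :: "int ^ 'd" where "v = (\<chi> i. N ^ e i)"
  have v: "idot u v = poly (p u) N" for u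
    by (simp add: idot_def v_def p_def poly_sum poly_monom)
  have "inj_on (\<lambda>m. idot m v) S"
  proof (rule inj_onI, rule ccontr)
    fix m n assume "m \<in> S" "n \<in> S" "idot m v = idot n v" "m \<noteq> n"
    moreover from this have "poly (p (m - n)) N = 0"
      by (simp add: v[symmetric] idot_diff)
    ultimately show False
      using N by (auto simp: B_def)
  qed
  moreover have "v $ j = 1"
    by (simp add: v_def e_def)
  ultimately show ?thesis by blast
qed

definition nonneg_on :: "int ^ 'd::finite \<Rightarrow> 'd lpoly \<Rightarrow> bool" where
  "nonneg_on v f \<longleftrightarrow> (\<forall>m\<in>Poly_Mapping.keys f. 0 \<le> idot m v)"

text \<open>The substitution \<open>z\<^sup>m \<mapsto> z\<^sup>m x\<^bsup>m\<cdot>v\<^esup>\<close>. Since \<^const>\<open>nat\<close> truncates, it is multiplicative only on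
  Laurent polynomials that satisfy \<open>nonneg_on v\<close>.\<close>
definition line :: "int ^ 'd::finite \<Rightarrow> 'd lpoly \<Rightarrow> 'd lpoly poly" where
  "line v = lin_ext (\<lambda>c. [:Poly_Mapping.single 0 c:])
     (\<lambda>m. monom (Poly_Mapping.single m 1) (nat (idot m v)))"

lemmas comm_ring_hom_const_single =
  comm_ring_hom_compose[OF comm_ring_hom_const_poly comm_ring_hom_single]

lemma line_single: "line v (Poly_Mapping.single m c) = monom (Poly_Mapping.single m c) (nat (idot m v))"
  unfolding line_def
  by (subst comm_ring_hom.lin_ext_single[OF comm_ring_hom_const_single])
     (simp add: smult_monom mult_single)

lemma line_zero [simp]: "line v 0 = 0"
  by (simp add: line_def lin_ext_def)

lemma line_sum: "line v (\<Sum>i\<in>I. f i) = (\<Sum>i\<in>I. line v (f i))"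
  unfolding line_def by (rule comm_ring_hom.lin_ext_sum[OF comm_ring_hom_const_single])

lemma line_add: "line v (p + q) = line v p + line v q"
  unfolding line_def by (rule comm_ring_hom.lin_ext_add[OF comm_ring_hom_const_single])

lemma line_mult:
  assumes "nonneg_on v p" "nonneg_on v q"
  shows "line v (p * q) = line v p * line v q"
  unfolding line_def
proof (rule comm_ring_hom.lin_ext_mult[OF comm_ring_hom_const_single])
  fix a b assume "a \<in> Poly_Mapping.keys p" "b \<in> Poly_Mapping.keys q"
  then have "0 \<le> idot a v" "0 \<le> idot b v"
    using assms by (auto simp: nonneg_on_def)
  then show "monom (Poly_Mapping.single (a + b) 1) (nat (idot (a + b) v)) =
      monom (Poly_Mapping.single a (1::complex)) (nat (idot a v)) * monom (Poly_Mapping.single b 1) (nat (idot b v))"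
    by (simp add: mult_monom mult_single nat_add_distrib)
qed

lemma nonneg_on_mult:
  assumes "nonneg_on v p" "nonneg_on v q" shows "nonneg_on v (p * q)"
  unfolding nonneg_on_def
proof
  fix m assume "m \<in> Poly_Mapping.keys (p * q)"
  then obtain a b where "m = a + b" "a \<in> Poly_Mapping.keys p" "b \<in> Poly_Mapping.keys q"
    using keys_mult by blast
  then show "0 \<le> idot m v"
    using assms by (auto simp: nonneg_on_def)
qed

lemma nonneg_on_single: "0 \<le> idot m v \<Longrightarrow> nonneg_on v (Poly_Mapping.single m c)"
  by (auto simp: nonneg_on_def)

lemma nonneg_on_one: "nonneg_on v 1"
  by (simp add: nonneg_on_def)

lemma nonneg_on_zero: "nonneg_on v 0"
  by (simp add: nonneg_on_def)

lemma nonneg_on_power: "nonneg_on v p \<Longrightarrow> nonneg_on v (p ^ n)"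
  by (induction n) (auto intro: nonneg_on_one nonneg_on_mult)

lemma line_one: "line v 1 = 1"
  using line_single[of v 0 1] by simp

lemma line_power: "nonneg_on v p \<Longrightarrow> line v (p ^ n) = line v p ^ n"
  by (induction n) (simp_all add: line_one line_mult nonneg_on_power)

text \<open>Setting the line parameter to 1 undoes the substitution; it brings identities found
  along lines back to the Laurent ring.\<close>

lemma poly_line_1: "poly (line v f) 1 = f"
proof -
  have "poly (line v f) 1 = (\<Sum>m\<in>Poly_Mapping.keys f. Poly_Mapping.single m (Poly_Mapping.lookup f m))"
    by (subst poly_mapping_sum_single[of f]) (simp add: line_sum line_single poly_sum poly_monom)
  then show ?thesis
    by (simp add: poly_mapping_sum_single[symmetric])
qed

text \<open>The direction separates the exponents of \<open>f\<close>, so different terms land in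
  different powers of the parameter and the top coefficient is a single term, a unit.\<close>

lemma line_degree_lead_coeff:
  assumes "inj_on (\<lambda>m. idot m v) (Poly_Mapping.keys f)" "nonneg_on v f" "f \<noteq> 0"
  shows "\<exists>m c. c \<noteq> 0 \<and> lead_coeff (line v f) = Poly_Mapping.single m c"
proof -
  have coeff: "coeff (line v f) n = (\<Sum>m\<in>Poly_Mapping.keys f.
      if nat (idot m v) = n then Poly_Mapping.single m (Poly_Mapping.lookup f m) else 0)" for n
    by (subst poly_mapping_sum_single[of f]) (simp add: line_sum line_single coeff_sum)
  have "line v f \<noteq> 0"
    using poly_line_1[of v f] assms(3) by auto
  then have nz: "lead_coeff (line v f) \<noteq> 0"
    by simp
  define n where "n = degree (line v f)"
  have "\<exists>m\<in>Poly_Mapping.keys f. nat (idot m v) = n"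
  proof (rule ccontr)
    assume "\<not> ?thesis"
    then have "coeff (line v f) n = 0"
      unfolding coeff by (intro sum.neutral) auto
    with nz show False
      by (simp add: n_def)
  qed
  then obtain m where m: "m \<in> Poly_Mapping.keys f" "nat (idot m v) = n"
    by blast
  have "nat (idot m' v) = n \<longleftrightarrow> m' = m" if "m' \<in> Poly_Mapping.keys f" for m'
  proof
    assume "nat (idot m' v) = n"
    then have "idot m' v = idot m v"
      using assms(2) m that unfolding nonneg_on_def by (metis int_nat_eq)
    then show "m' = m"
      using inj_onD[OF assms(1)] m(1) that by blast
  qed (use m in simp)
  then have "lead_coeff (line v f) = (\<Sum>m'\<in>Poly_Mapping.keys f.
      if m' = m then Poly_Mapping.single m (Poly_Mapping.lookup f m) else 0)"
    unfolding coeff n_def[symmetric] by (intro sum.cong) auto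
  also have "\<dots> = Poly_Mapping.single m (Poly_Mapping.lookup f m)"
    using m by simp
  finally show ?thesis
    using m by (auto simp: in_keys_iff)
qed

lemma single_mult_single_uminus:
  "Poly_Mapping.single (- m) 1 * Poly_Mapping.single m (1::complex) = (1 :: 'd::finite lpoly)"
  by (simp add: mult_single)

text \<open>As \<open>v $ j = 1\<close>, the monomial factor adds \<open>N\<close> to every pairing
  with \<open>v\<close>. The bound covers all large \<open>N\<close>, so that one power can serve
  several polynomials.\<close>

lemma shift_nonneg:
  fixes v :: "int ^ 'd::finite"
  assumes "v $ j = 1"
  shows "\<exists>N0. \<forall>N\<ge>N0. nonneg_on v (Poly_Mapping.single (axis j (int N)) 1 * f)"
proof -
  define N0 where "N0 = nat (\<Sum>m\<in>Poly_Mapping.keys f. \<bar>idot m v\<bar>)"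
  have N0: "\<bar>idot m v\<bar> \<le> int N0" if "m \<in> Poly_Mapping.keys f" for m
    using member_le_sum[of m "Poly_Mapping.keys f" "\<lambda>m. \<bar>idot m v\<bar>"] that
    by (simp add: N0_def sum_nonneg)
  have "nonneg_on v (Poly_Mapping.single (axis j (int N)) 1 * f)" if "N \<ge> N0" for N
    unfolding nonneg_on_def
  proof
    fix m assume "m \<in> Poly_Mapping.keys (Poly_Mapping.single (axis j (int N)) 1 * f)"
    then obtain b where "m = axis j (int N) + b" "b \<in> Poly_Mapping.keys f"
      using keys_mult[of "Poly_Mapping.single (axis j (int N)) 1" f] by auto
    then show "0 \<le> idot m v"
      using N0[of b] assms that by simp
  qed
  then show ?thesis by blast
qed

lemma inj_on_shift:
  assumes "inj_on (\<lambda>m. idot m v) (Poly_Mapping.keys f)"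
  shows "inj_on (\<lambda>m. idot m v) (Poly_Mapping.keys (Poly_Mapping.single a c * f))"
proof (rule inj_on_subset)
  show "inj_on (\<lambda>m. idot m v) ((+) a ` Poly_Mapping.keys f)"
    using assms by (auto simp: inj_on_def)
  show "Poly_Mapping.keys (Poly_Mapping.single a c * f) \<subseteq> (+) a ` Poly_Mapping.keys f"
    using keys_mult[of "Poly_Mapping.single a c" f] by (auto split: if_splits)
qed

subsection \<open>Zero sets of trigonometric polynomials\<close>

definition real_vec :: "int ^ 'd::finite \<Rightarrow> real ^ 'd" where
  "real_vec v = (\<chi> j. of_int (v $ j))"

lemma dotk_real_vec: "dotk m (real_vec v) = of_int (idot m v)"
  by (simp add: dotk_def real_vec_def idot_def)

lemma eval_torus_line:
  assumes "nonneg_on v f"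
  shows "eval_torus f (k + t *\<^sub>R real_vec v)
    = poly (map_poly (\<lambda>p. eval_torus p k) (line v f)) (exp (2 * pi * \<i> * complex_of_real t))"
proof -
  have *: "cis_char m (t *\<^sub>R real_vec v) = exp (2 * pi * \<i> * complex_of_real t) ^ nat (idot m v)"
    if "m \<in> Poly_Mapping.keys f" for m
  proof -
    have "idot m v = int (nat (idot m v))"
      using assms that by (auto simp: nonneg_on_def)
    then have "of_int (idot m v) = (of_nat (nat (idot m v)) :: complex)"
      by (metis of_int_of_nat_eq)
    then show ?thesis
      unfolding cis_char_def exp_of_nat_mult[symmetric] by (simp add: dotk_real_vec mult_ac)
  qed
  interpret mp: comm_ring_hom "map_poly (\<lambda>p. eval_torus p k)"
    by (rule eval_torus.map_poly_hom)
  have "map_poly (\<lambda>p. eval_torus p k) (line v f) = (\<Sum>m\<in>Poly_Mapping.keys f.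
      monom (Poly_Mapping.lookup f m * cis_char m k) (nat (idot m v)))"
    by (subst poly_mapping_sum_single[of f])
       (simp add: line_sum line_single mp.hom_sum map_poly_monom eval_torus.hom_zero eval_torus_single)
  then show ?thesis
    by (simp add: poly_sum poly_monom eval_torus_lin_ext lin_ext_def * mult_ac)
qed

text \<open>The top coefficient is a monomial, which vanishes nowhere on the torus; the degree
  therefore drops at no \<open>k\<close>.\<close>

lemma line_eval_nonzero:
  assumes "inj_on (\<lambda>m. idot m v) (Poly_Mapping.keys f)" "nonneg_on v f" "f \<noteq> 0"
  shows "degree (map_poly (\<lambda>p. eval_torus p k) (line v f)) = degree (line v f)"
    and "map_poly (\<lambda>p. eval_torus p k) (line v f) \<noteq> 0"
proof -
  obtain m c where "c \<noteq> 0" "lead_coeff (line v f) = Poly_Mapping.single m c"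
    using line_degree_lead_coeff[OF assms] by blast
  then have *: "eval_torus (lead_coeff (line v f)) k \<noteq> 0"
    by (simp add: eval_torus_single)
  then show "degree (map_poly (\<lambda>p. eval_torus p k) (line v f)) = degree (line v f)"
    by (intro map_poly_degree_eq) auto
  show "map_poly (\<lambda>p. eval_torus p k) (line v f) \<noteq> 0"
    using * by (metis eval_torus.coeff_map_hom coeff_0)
qed

lemma finite_exp_roots:
  assumes "p \<noteq> 0"
  shows "finite {t \<in> {0..<1}. poly p (exp (2 * pi * \<i> * complex_of_real t)) = 0}"
proof -
  let ?e = "\<lambda>t. exp (2 * pi * \<i> * complex_of_real t)"
  have "inj_on ?e {0..<1}"
  proof (rule inj_onI)
    fix s t :: real assume st: "s \<in> {0..<1}" "t \<in> {0..<1}" and eq: "?e s = ?e t"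
    obtain n :: int where "2 * pi * \<i> * complex_of_real s = 2 * pi * \<i> * complex_of_real t + (of_int (2 * n) * pi) * \<i>"
      using eq unfolding exp_eq by blast
    then have "complex_of_real (2 * pi) * \<i> * (complex_of_real s - complex_of_real t - of_int n) = 0"
      by (simp add: algebra_simps)
    then have "complex_of_real (s - t - of_int n) = 0"
      by simp
    then have n: "s - t = of_int n"
      by (simp only: of_real_eq_0_iff)
    then have "n = 0"
      using st by auto
    with n show "s = t" by simp
  qed
  then have "finite (?e -` {x. poly p x = 0} \<inter> {0..<1})"
    using assms poly_roots_finite by (intro finite_vimage_IntI) auto
  then show ?thesis
    by (rule rev_finite_subset) auto
qed

lemma continuous_on_eval_torus: "continuous_on UNIV (eval_torus f)"
  unfolding eval_torus_def dotk_def by (intro continuous_intros)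

text \<open>By translation invariance the measure of \<open>Z\<close> is the average over
  \<open>t\<close> in [0,1) of the measures of its translates along \<open>v\<close>. Exchanging the
  integrals leaves inner integrals over finite sets. Closedness supplies measurability.\<close>

lemma negligible_by_lines:
  fixes Z :: "(real ^ 'd::finite) set"
  assumes "closed Z"
    and lines: "\<And>k. finite {t \<in> {0..<1}. k + t *\<^sub>R v \<in> Z}"
  shows "negligible Z"
proof -
  have Z [measurable]: "Z \<in> sets borel"
    using assms(1) by simp
  have meas: "(\<lambda>(t, k). indicator {0..<1} t * indicator Z (k + t *\<^sub>R v) :: ennreal)
      \<in> borel_measurable (lborel \<Otimes>\<^sub>M lborel)"
    by measurable
  have plus: "(\<integral>\<^sup>+k. indicator Z (k + t *\<^sub>R v) \<partial>lborel) = emeasure lborel Z" for t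
  proof -
    have "(\<integral>\<^sup>+k. indicator Z (k + t *\<^sub>R v) \<partial>lborel) = (\<integral>\<^sup>+k. indicator Z k \<partial>distr lborel borel ((+) (t *\<^sub>R v)))"
      by (subst nn_integral_distr) (auto simp: add.commute)
    then show ?thesis
      by (simp add: lborel_distr_plus)
  qed
  have null: "(\<integral>\<^sup>+t. indicator {0..<1} t * indicator Z (k + t *\<^sub>R v) \<partial>lborel) = 0" for k
  proof -
    have "(\<integral>\<^sup>+t. indicator {0..<1} t * indicator Z (k + t *\<^sub>R v) \<partial>lborel)
        = (\<integral>\<^sup>+t. indicator {t \<in> {0..<1}. k + t *\<^sub>R v \<in> Z} t \<partial>lborel)"
      by (intro nn_integral_cong) (auto simp: indicator_def)
    also have "\<dots> = emeasure lborel {t \<in> {0..<1}. k + t *\<^sub>R v \<in> Z}"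
      using lines[of k] by (intro nn_integral_indicator) (auto intro: finite_imp_closed borel_closed)
    also have "\<dots> = 0"
      using lines[of k] by (intro emeasure_lborel_countable countable_finite)
    finally show ?thesis .
  qed
  have "emeasure lborel Z = (\<integral>\<^sup>+t. emeasure lborel Z * indicator {0..<1} t \<partial>(lborel :: real measure))"
    by (subst nn_integral_cmult_indicator) auto
  also have "\<dots> = (\<integral>\<^sup>+t. (\<integral>\<^sup>+k. indicator {0..<1} t * indicator Z (k + t *\<^sub>R v) \<partial>lborel) \<partial>lborel)"
    by (subst nn_integral_cmult) (auto simp: plus mult.commute)
  also have "\<dots> = (\<integral>\<^sup>+k. (\<integral>\<^sup>+t. indicator {0..<1} t * indicator Z (k + t *\<^sub>R v) \<partial>lborel) \<partial>lborel)"
    using lborel_pair.Fubini'[OF meas] by simp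
  also have "\<dots> = 0"
    by (simp add: null)
  finally have "Z \<in> null_sets lborel"
    by (simp add: null_sets_def)
  then show ?thesis
    using negligible_iff_null_sets null_sets_completionI by blast
qed

lemma negligible_zeros:
  fixes f :: "'d::finite lpoly"
  assumes "f \<noteq> 0"
  shows "negligible {k. eval_torus f k = 0}"
proof -
  \<comment> \<open>Any coordinate serves; one exists because types are nonempty.\<close>
  fix j :: 'd
  obtain v where v: "v $ j = 1" "inj_on (\<lambda>m. idot m v) (Poly_Mapping.keys f)"
    using generic_direction[of "Poly_Mapping.keys f" j] by auto
  obtain N where N: "nonneg_on v (Poly_Mapping.single (axis j (int N)) 1 * f)"
    using shift_nonneg[OF v(1), of f] by blast
  \<comment> \<open>A monomial factor makes all pairings with \<open>v\<close> nonnegative and keeps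
    the zero set.\<close>
  define g where "g = Poly_Mapping.single (axis j (int N)) 1 * f"
  have "Poly_Mapping.single (- axis j (int N)) 1 * g = f"
    unfolding g_def mult.assoc[symmetric] single_mult_single_uminus by simp
  then have g: "g \<noteq> 0"
    using assms by auto
  have inj: "inj_on (\<lambda>m. idot m v) (Poly_Mapping.keys g)"
    unfolding g_def by (rule inj_on_shift[OF v(2)])
  have eq: "{k. eval_torus f k = 0} = {k. eval_torus g k = 0}"
    by (simp add: g_def eval_torus.hom_mult eval_torus_single)
  have "closed {k. eval_torus g k = 0}"
    using continuous_on_eval_torus[of g] by (intro closed_Collect_eq) auto
  then show ?thesis
    unfolding eq
  proof (rule negligible_by_lines)
    show "finite {t \<in> {0..<1}. k + t *\<^sub>R real_vec v \<in> {k. eval_torus g k = 0}}" for k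
      using finite_exp_roots[OF line_eval_nonzero(2)[OF inj N[folded g_def] g, of k]]
      by (simp add: eval_torus_line[OF N[folded g_def]])
  qed
qed

lemma eval_torus_eq_0_imp:
  assumes "\<And>k. eval_torus f k = 0" shows "f = 0"
  using negligible_zeros[of f] assms by auto

text \<open>The zero sets of two nonzero factors are null, so they cannot cover the whole
  space.\<close>

lemma lpoly_no_zero_divisors:
  fixes f g :: "'d::finite lpoly"
  assumes "f * g = 0" shows "f = 0 \<or> g = 0"
proof (rule ccontr)
  assume "\<not> (f = 0 \<or> g = 0)"
  then have "negligible ({k. eval_torus f k = 0} \<union> {k. eval_torus g k = 0})"
    by (intro negligible_Un negligible_zeros) auto
  moreover have "eval_torus f k * eval_torus g k = 0" for k
    by (simp only: eval_torus.hom_mult[symmetric] assms eval_torus.hom_zero)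
  then have "{k. eval_torus f k = 0} \<union> {k. eval_torus g k = 0} = UNIV"
    by auto
  ultimately show False by simp
qed

subsection \<open>A Gauss lemma for monic polynomials over Laurent polynomials\<close>

text \<open>The Gauss lemma over C[x]: leading coefficients and contents are compared in
  \<open>eq\<close>, and \<open>content Q\<close> divides \<open>lead_coeff Q\<close>. The factor
  \<open>lead_coeff P\<close> is present because clearing negative exponents multiplies a monic
  polynomial by a monomial.\<close>

lemma lead_coeff_dvd_content:
  fixes P G Q :: "complex poly poly"
  assumes eq: "smult (lead_coeff G ^ N) P = G * Q" and "G \<noteq> 0"
  shows "lead_coeff G dvd lead_coeff P * coeff G i"
proof -
  define B where "B = lead_coeff G"
  have B: "B \<noteq> 0"
    using assms(2) by (simp add: B_def)
  have lc: "B ^ N * lead_coeff P = B * lead_coeff Q"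
    using arg_cong[OF eq, of lead_coeff] assms(2) by (simp add: lead_coeff_mult B_def)
  have c: "normalize (B ^ N) * content P = content G * content Q"
    using arg_cong[OF eq, of content] by (simp add: content_mult B_def)
  obtain w where w: "lead_coeff Q = content Q * w"
    using content_dvd_coeff[of Q "degree Q"] by blast
  \<comment> \<open>\<open>normalize\<close> changes \<open>B ^ N\<close> by a unit, recorded as
    \<open>e\<close>.\<close>
  obtain e where e: "normalize (B ^ N) = B ^ N * e"
    by (metis dvdE dvd_normalize_iff dvd_refl)
  have "B ^ N * (content G * lead_coeff P) = content G * (B * (content Q * w))"
    using lc w by (simp add: mult_ac)
  also have "\<dots> = B * w * (content G * content Q)"
    by (simp add: mult_ac)
  also have "\<dots> = B ^ N * (B * (w * e * content P))"
    unfolding c[symmetric] e by (simp add: mult_ac)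
  finally have "content G * lead_coeff P = B * (w * e * content P)"
    using B by simp
  then have "B dvd content G * lead_coeff P"
    by simp
  also have "\<dots> dvd coeff G i * lead_coeff P"
    by (intro mult_dvd_mono) auto
  finally show ?thesis
    by (simp add: B_def mult.commute)
qed

text \<open>When \<open>nonneg_on v f\<close> holds, this is the restriction of \<open>f\<close> to
  the line through \<open>k\<close> in direction \<open>v\<close>, as a polynomial in
  \<open>exp (2 pi i t)\<close>.\<close>

definition line_at :: "int ^ 'd::finite \<Rightarrow> real ^ 'd \<Rightarrow> 'd lpoly \<Rightarrow> complex poly" where
  "line_at v k f = map_poly (\<lambda>p. eval_torus p k) (line v f)"

lemma line_at_zero [simp]: "line_at v k 0 = 0"
  by (simp add: line_at_def)

lemma line_at_add: "line_at v k (f + g) = line_at v k f + line_at v k g"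
  by (simp add: line_at_def line_add comm_ring_hom.hom_add[OF eval_torus.map_poly_hom])

lemma line_at_sum: "line_at v k (\<Sum>i\<in>I. f i) = (\<Sum>i\<in>I. line_at v k (f i))"
  by (induction I rule: infinite_finite_induct) (simp_all add: line_at_add)

lemma line_at_mult:
  "nonneg_on v f \<Longrightarrow> nonneg_on v g \<Longrightarrow> line_at v k (f * g) = line_at v k f * line_at v k g"
  by (simp add: line_at_def line_mult comm_ring_hom.hom_mult[OF eval_torus.map_poly_hom])

lemma line_at_power: "nonneg_on v f \<Longrightarrow> line_at v k (f ^ n) = line_at v k f ^ n"
  by (simp add: line_at_def line_power comm_ring_hom.hom_power[OF eval_torus.map_poly_hom])

lemma line_at_single_nonzero: "c \<noteq> 0 \<Longrightarrow> line_at v k (Poly_Mapping.single m c) \<noteq> 0"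
  by (simp add: line_at_def line_single map_poly_monom eval_torus.hom_zero eval_torus_single)

text \<open>The leading coefficient of \<open>b\<close> along a generic direction is a monomial, hence a unit, so
  division with remainder by \<open>b\<close> is possible uniformly in \<open>k\<close>.\<close>
lemma dvd_if_dvd_on_lines:
  assumes inj: "inj_on (\<lambda>m. idot m v) (Poly_Mapping.keys b)" and b: "nonneg_on v b" "b \<noteq> 0"
    and dvd: "\<And>k. line_at v k b dvd line_at v k a"
  shows "b dvd a"
proof -
  obtain m c where c: "c \<noteq> 0" and lc: "lead_coeff (line v b) = Poly_Mapping.single m c"
    using line_degree_lead_coeff[OF inj b] by blast
  have q0: "line v b \<noteq> 0"
    using poly_line_1[of v b] b(2) by auto
  obtain x r where xr: "pseudo_divmod (line v a) (line v b) = (x, r)"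
    by fastforce
  define n where "n = Suc (degree (line v a)) - degree (line v b)"
  have div: "smult (Poly_Mapping.single m c ^ n) (line v a) = line v b * x + r"
    using pseudo_divmod(1)[OF q0 xr] unfolding lc n_def .
  have deg: "r = 0 \<or> degree r < degree (line v b)"
    using pseudo_divmod(2)[OF q0 xr] .
  \<comment> \<open>At each \<open>k\<close> the remainder is divisible by
    \<open>line_at v k b\<close>, whose degree does not depend on \<open>k\<close> and exceeds that
    of a nonzero \<open>r\<close>.\<close>
  have r: "map_poly (\<lambda>p. eval_torus p k) r = 0" for k
  proof -
    interpret mp: comm_ring_hom "map_poly (\<lambda>p. eval_torus p k)"
      by (rule eval_torus.map_poly_hom)
    have "map_poly (\<lambda>p. eval_torus p k) r
      = smult (eval_torus (Poly_Mapping.single m c ^ n) k) (line_at v k a)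
        - line_at v k b * map_poly (\<lambda>p. eval_torus p k) x"
      using arg_cong[OF div, of "map_poly (\<lambda>p. eval_torus p k)"]
      by (simp add: mp.hom_add mp.hom_mult eval_torus.map_poly_hom_smult line_at_def)
    then have "line_at v k b dvd map_poly (\<lambda>p. eval_torus p k) r"
      using dvd[of k] by (simp add: dvd_smult)
    moreover have "degree (map_poly (\<lambda>p. eval_torus p k) r) < degree (line_at v k b)" if "r \<noteq> 0"
      using that deg line_eval_nonzero(1)[OF inj b, of k] map_poly_degree_leq[of "\<lambda>p. eval_torus p k" r]
      by (simp add: line_at_def eval_torus.hom_zero)
    ultimately show ?thesis
      by (metis dvd_imp_degree_le linorder_not_less map_poly_0)
  qed
  have "r = 0"
  proof (rule poly_eqI)
    fix i
    have "eval_torus (coeff r i) k = 0" for k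
      using arg_cong[OF r[of k], of "\<lambda>p. coeff p i"] by simp
    then show "coeff r i = coeff 0 i"
      by (simp add: eval_torus_eq_0_imp)
  qed
  \<comment> \<open>At parameter 1 the division identity returns to the Laurent ring, with a unit in
    front of \<open>a\<close>.\<close>
  then have eq: "Poly_Mapping.single m c ^ n * a = b * poly x 1"
    using arg_cong[OF div, of "\<lambda>p. poly p 1"] by (simp add: poly_line_1)
  have "Poly_Mapping.single (- m) (inverse c) * Poly_Mapping.single m c = (1 :: 'a lpoly)"
    using c by (simp add: mult_single)
  then have "Poly_Mapping.single (- m) (inverse c) ^ n * (Poly_Mapping.single m c ^ n * a) = a"
    by (simp add: mult.assoc[symmetric] power_mult_distrib[symmetric])
  then show ?thesis
    unfolding eq by (metis dvd_triv_left mult.left_commute)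
qed

lemma single_axis_mult:
  "Poly_Mapping.single (axis j (int a)) (1::complex) * Poly_Mapping.single (axis j (int b)) 1
    = Poly_Mapping.single (axis j (int (a + b))) 1"
proof -
  have "axis j (int a) + axis j (int b) = axis j (int (a + b))"
    by (simp add: vec_eq_iff axis_def)
  then show ?thesis
    by (simp add: mult_single)
qed

lemma shift_nonneg_poly:
  fixes v :: "int ^ 'd::finite"
  assumes "v $ j = 1"
  shows "\<exists>N0. \<forall>N\<ge>N0. \<forall>i. nonneg_on v (Poly_Mapping.single (axis j (int N)) 1 * coeff p i)"
proof -
  have "\<forall>i. \<exists>N0. \<forall>N\<ge>N0. nonneg_on v (Poly_Mapping.single (axis j (int N)) 1 * coeff p i)"
    using shift_nonneg[OF assms] by blast
  then obtain h where h: "\<And>i N. N \<ge> h i \<Longrightarrow> nonneg_on v (Poly_Mapping.single (axis j (int N)) 1 * coeff p i)"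
    by metis
  have "nonneg_on v (Poly_Mapping.single (axis j (int N)) 1 * coeff p i)"
    if "N \<ge> (\<Sum>i\<le>degree p. h i)" for N i
  proof (cases "i \<le> degree p")
    case True
    then have "h i \<le> (\<Sum>i\<le>degree p. h i)"
      by (intro member_le_sum) auto
    with that show ?thesis
      by (intro h) simp
  next
    case False
    then show ?thesis
      by (simp add: coeff_eq_0 nonneg_on_zero)
  qed
  then show ?thesis by blast
qed

text \<open>Once negative exponents are cleared, the identity restricts to every line, where the
  one-variable Gauss lemma applies; \<open>dvd_if_dvd_on_lines\<close> lifts the divisibility
  back.\<close>

lemma lead_coeff_dvd_coeff:
  fixes P G Q :: "'d::finite lpoly poly"
  assumes monic: "lead_coeff P = 1" and "G \<noteq> 0" and eq: "smult (lead_coeff G ^ N) P = G * Q"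
  shows "lead_coeff G dvd coeff G i"
proof -
  fix j :: 'd
  define b where "b = lead_coeff G"
  have b0: "b \<noteq> 0"
    using assms(2) by (simp add: b_def)
  obtain v where v: "v $ j = 1" "inj_on (\<lambda>m. idot m v) (Poly_Mapping.keys b)"
    using generic_direction[of "Poly_Mapping.keys b" j] by auto
  define u where "u n = Poly_Mapping.single (axis j (int n)) (1::complex)" for n
  have u: "u m * u n = u (m + n)" for m n
    unfolding u_def by (rule single_axis_mult)
  have u0: "u 0 = 1"
    by (simp add: u_def axis_def zero_vec_def[symmetric])
  have u_pow: "u m ^ n = u (m * n)" for m n
    by (induction n) (simp_all add: u u0)
  have u_nonneg: "nonneg_on v (u n)" for n
    unfolding u_def using v(1) by (intro nonneg_on_single) simp
  obtain n1 where n1: "\<And>n i. n \<ge> n1 \<Longrightarrow> nonneg_on v (u n * coeff G i)"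
    using shift_nonneg_poly[OF v(1), of G] unfolding u_def by blast
  obtain n2 where n2: "\<And>n i. n \<ge> n2 \<Longrightarrow> nonneg_on v (u n * coeff P i)"
    using shift_nonneg_poly[OF v(1), of P] unfolding u_def by blast
  obtain n3 where n3: "\<And>n i. n \<ge> n3 \<Longrightarrow> nonneg_on v (u n * coeff Q i)"
    using shift_nonneg_poly[OF v(1), of Q] unfolding u_def by blast
  \<comment> \<open>Chosen so that \<open>n1 * N + s = n1 + t\<close>, which balances the monomials
    on the two sides of \<open>eq\<close>, with \<open>s >= n2\<close> and
    \<open>t >= n3\<close>.\<close>
  define s where "s = n1 + n2 + n3"
  define t where "t = n1 * N + n2 + n3"
  define b' where "b' = u n1 * b"
  have nG: "nonneg_on v (u n1 * coeff G i)" and nP: "nonneg_on v (u s * coeff P i)"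
    and nQ: "nonneg_on v (u t * coeff Q i)" for i
    using n1 n2 n3 by (auto simp: s_def t_def)
  have nb: "nonneg_on v b'"
    using nG[of "degree G"] by (simp add: b'_def b_def)
  have inj: "inj_on (\<lambda>m. idot m v) (Poly_Mapping.keys b')"
    unfolding b'_def u_def by (rule inj_on_shift[OF v(2)])
  have u_inv: "\<exists>w. w * u n = 1" for n
    unfolding u_def using single_mult_single_uminus by blast
  have b'0: "b' \<noteq> 0"
  proof
    assume "b' = 0"
    moreover obtain w where "w * u n1 = 1"
      using u_inv by blast
    then have "w * b' = b"
      by (simp add: b'_def mult.assoc[symmetric])
    ultimately show False
      using b0 by simp
  qed
  \<comment> \<open>The coefficients of \<open>eq\<close> times \<open>u n1 ^ N * u s\<close>: all
    factors now satisfy \<open>nonneg_on v\<close>, so \<open>line_at\<close> respects the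
    products.\<close>
  have eq': "b' ^ N * (u s * coeff P i) = (\<Sum>l\<le>i. (u n1 * coeff G l) * (u t * coeff Q (i - l)))" for i
  proof -
    have "b' ^ N * (u s * coeff P i) = (u n1 ^ N * u s) * (b ^ N * coeff P i)"
      by (simp add: b'_def power_mult_distrib mult_ac)
    also have "b ^ N * coeff P i = (\<Sum>l\<le>i. coeff G l * coeff Q (i - l))"
      using arg_cong[OF eq, of "\<lambda>p. coeff p i"] by (simp add: b_def coeff_mult)
    also have "u n1 ^ N * u s = u n1 * u t"
      by (simp add: u_pow u s_def t_def add_ac)
    finally show ?thesis
      by (simp add: sum_distrib_left mult_ac)
  qed
  have dvd: "line_at v k b' dvd line_at v k (u s * (u n1 * coeff G i))" for k
  proof -
    define GG where "GG = map_poly (\<lambda>c. line_at v k (u n1 * c)) G"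
    define PP where "PP = map_poly (\<lambda>c. line_at v k (u s * c)) P"
    define QQ where "QQ = map_poly (\<lambda>c. line_at v k (u t * c)) Q"
    have cG: "coeff GG i = line_at v k (u n1 * coeff G i)" and cP: "coeff PP i = line_at v k (u s * coeff P i)"
      and cQ: "coeff QQ i = line_at v k (u t * coeff Q i)" for i
      by (simp_all add: GG_def PP_def QQ_def coeff_map_poly)
    have lb: "line_at v k b' \<noteq> 0"
      using line_eval_nonzero(2)[OF inj nb b'0] by (simp add: line_at_def)
    have lu: "line_at v k (u s) \<noteq> 0"
      unfolding u_def by (rule line_at_single_nonzero) simp
    have dG: "degree GG = degree G"
      unfolding GG_def using lb by (intro map_poly_degree_eq) (simp_all add: b'_def b_def)
    have dP: "degree PP = degree P"
      unfolding PP_def using lu monic by (intro map_poly_degree_eq) simp_all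
    have lG: "lead_coeff GG = line_at v k b'"
      by (simp add: dG cG b'_def b_def)
    \<comment> \<open>\<open>P\<close> is monic, so only the clearing monomial is left.\<close>
    have lP: "lead_coeff PP = line_at v k (u s)"
      using monic by (simp add: dP cP)
    have "smult (lead_coeff GG ^ N) PP = GG * QQ"
    proof (rule poly_eqI)
      fix i
      have "coeff (smult (lead_coeff GG ^ N) PP) i = line_at v k (b' ^ N * (u s * coeff P i))"
        by (simp only: lG coeff_smult cP line_at_power[OF nb] line_at_mult[OF nonneg_on_power[OF nb] nP])
      also have "\<dots> = (\<Sum>l\<le>i. coeff GG l * coeff QQ (i - l))"
        unfolding eq' line_at_sum cG cQ by (simp add: line_at_mult nG nQ)
      finally show "coeff (smult (lead_coeff GG ^ N) PP) i = coeff (GG * QQ) i"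
        by (simp add: coeff_mult)
    qed
    moreover have "GG \<noteq> 0"
      using lG lb by auto
    ultimately have "lead_coeff GG dvd lead_coeff PP * coeff GG i"
      by (rule lead_coeff_dvd_content)
    then show ?thesis
      unfolding line_at_mult[OF u_nonneg nG] lG lP unfolding cG by simp
  qed
  have "b' dvd u s * (u n1 * coeff G i)"
    by (rule dvd_if_dvd_on_lines[OF inj nb b'0 dvd])
  then have "b dvd u (s + n1) * coeff G i"
    unfolding b'_def by (metis dvd_mult_right mult.assoc u)
  moreover obtain w where "w * u (s + n1) = 1"
    using u_inv by blast
  then have "w * (u (s + n1) * coeff G i) = coeff G i"
    by (simp add: mult.assoc[symmetric])
  ultimately show ?thesis
    unfolding b_def by (metis dvd_mult)
qed

subsection \<open>Resultants\<close>

lemma coeff_monic_mult: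
  fixes G T :: "'a::comm_ring_1 poly"
  assumes "lead_coeff G = 1"
  shows "coeff (G * T) (degree G + degree T) = lead_coeff T"
  using assms by (simp add: coeff_mult_degree_sum)

text \<open>A leading coefficient 1 cannot be cancelled, so degrees add even in the presence of zero
  divisors.\<close>

lemma degree_monic_mult:
  fixes G T :: "'a::comm_ring_1 poly"
  assumes "lead_coeff G = 1" "T \<noteq> 0"
  shows "degree (G * T) = degree G + degree T"
proof (rule antisym)
  show "degree G + degree T \<le> degree (G * T)"
    using assms coeff_monic_mult[OF assms(1), of T] by (intro le_degree) simp
qed (rule degree_mult_le)

lemma monic_not_dvd_lower_degree:
  fixes G F :: "'a::comm_ring_1 poly"
  assumes "lead_coeff G = 1" "F \<noteq> 0" "degree F < degree G"
  shows "\<not> G dvd F"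
proof
  assume "G dvd F"
  then obtain T where "F = G * T" by blast
  with assms(2) have "degree F = degree G + degree T"
    by (cases "T = 0") (simp_all add: degree_monic_mult[OF assms(1)])
  with assms(3) show False by simp
qed

lemma monic_dvd_1:
  fixes G :: "'a::comm_ring_1 poly"
  assumes "lead_coeff G = 1" "G dvd 1"
  shows "G = 1"
proof -
  have "degree G = 0"
    using monic_not_dvd_lower_degree[OF assms(1), of 1] assms(2) by auto
  with assms(1) show ?thesis
    by (metis degree_0_id one_pCons)
qed

lemma lpoly_power_nonzero:
  fixes b :: "'d::finite lpoly"
  shows "b \<noteq> 0 \<Longrightarrow> b ^ n \<noteq> 0"
  by (induction n) (auto dest: lpoly_no_zero_divisors)

text \<open>Division by the monic \<open>G\<close> leaves a remainder \<open>r\<close> of smaller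
  degree such that \<open>G\<close> divides \<open>smult c r\<close>; this forces
  \<open>smult c r = 0\<close>, hence \<open>r = 0\<close>.\<close>

lemma monic_dvd_smult_cancel:
  fixes G F :: "'d::finite lpoly poly"
  assumes monic: "lead_coeff G = 1" and "c \<noteq> 0" and dvd: "G dvd smult c F"
  shows "G dvd F"
proof -
  have G0: "G \<noteq> 0"
    using monic by auto
  obtain y r where yr: "pseudo_divmod F G = (y, r)"
    by fastforce
  have F: "F = G * y + r"
    using pseudo_divmod(1)[OF G0 yr] monic by simp
  obtain q where q: "smult c F = G * q"
    using dvd by blast
  have "smult c r = G * (q - smult c y)"
    using q unfolding F by (simp add: smult_add_right algebra_simps)
  then have "G dvd smult c r"
    by simp
  moreover have "degree (smult c r) < degree G" if "smult c r \<noteq> 0"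
    using that pseudo_divmod(2)[OF G0 yr] degree_smult_le[of c r] by auto
  ultimately have "smult c r = 0"
    using monic_not_dvd_lower_degree[OF monic] by blast
  have "r = 0"
  proof (rule poly_eqI)
    fix i
    have "c * coeff r i = 0"
      using arg_cong[OF \<open>smult c r = 0\<close>, of "\<lambda>p. coeff p i"] by simp
    then show "coeff r i = coeff 0 i"
      using \<open>c \<noteq> 0\<close> lpoly_no_zero_divisors by fastforce
  qed
  then show ?thesis
    by (simp add: F)
qed

text \<open>Elimination of lambda: \<open>D\<close> takes the place of the resultant of
  \<open>P\<close> and \<open>H\<close>.\<close>

lemma irreducible_bezout:
  fixes P H :: "'d::finite lpoly poly"
  assumes irr: "irreducible P" and monic: "lead_coeff P = 1" and ndvd: "\<not> P dvd H"
  shows "\<exists>U V D. D \<noteq> 0 \<and> U * P + V * H = [:D:]"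
proof -
  define I where "I F \<longleftrightarrow> (\<exists>U V. F = U * P + V * H)" for F
  have IP: "I P" and IH: "I H"
    unfolding I_def by (rule exI[of _ 1], rule exI[of _ 0], simp, rule exI[of _ 0], rule exI[of _ 1], simp)
  have I_comb: "I (A * X + B * Y)" if XY: "I X" "I Y" for A B X Y
  proof -
    obtain U V U' V' where "X = U * P + V * H" "Y = U' * P + V' * H"
      using XY unfolding I_def by blast
    then have "A * X + B * Y = (A * U + B * U') * P + (A * V + B * V') * H"
      by (simp add: algebra_simps)
    then show ?thesis
      unfolding I_def by blast
  qed
  have P0: "P \<noteq> 0"
    using monic by auto
  obtain G where G: "I G" "G \<noteq> 0" and min: "\<And>F. I F \<Longrightarrow> F \<noteq> 0 \<Longrightarrow> degree G \<le> degree F"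
    using ex_has_least_nat[of "\<lambda>F. I F \<and> F \<noteq> 0" P degree] IP P0 by blast
  define b where "b = lead_coeff G"
  have b0: "b \<noteq> 0"
    using G by (simp add: b_def)
  \<comment> \<open>The pseudo-remainder lies in the ideal and would have smaller degree than
    \<open>G\<close>, so it is zero by minimality.\<close>
  have multiple: "\<exists>N q. smult (b ^ N) F = G * q" if F: "I F" for F
  proof -
    obtain q r where qr: "pseudo_divmod F G = (q, r)"
      by fastforce
    obtain N where N: "smult (b ^ N) F = G * q + r"
      using pseudo_divmod(1)[OF G(2) qr] unfolding b_def by blast
    then have "r = [:b ^ N:] * F + (- q) * G"
      by (simp add: algebra_simps)
    then have "I r"
      using I_comb[OF F G(1), of "[:b ^ N:]" "- q"] by (simp only:)
    then have "r = 0"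
      using pseudo_divmod(2)[OF G(2) qr] min[of r] by fastforce
    with N show ?thesis by auto
  qed
  have "degree G = 0"
  proof (rule ccontr)
    assume d: "degree G \<noteq> 0"
    obtain N q where Nq: "smult (b ^ N) P = G * q"
      using multiple[OF IP] by blast
    have "b dvd coeff G i" for i
      using lead_coeff_dvd_coeff[OF monic G(2) Nq[unfolded b_def]] by (simp add: b_def)
    then have "\<forall>i. \<exists>c. coeff G i = b * c"
      by (auto simp: dvd_def)
    then obtain w where w: "\<And>i. coeff G i = b * w i"
      by metis
    \<comment> \<open>The quotient of \<open>G\<close> by its leading coefficient
      \<open>b\<close>.\<close>
    define G' where "G' = (\<Sum>i\<le>degree G. monom (w i) i)"
    have coeff_G': "coeff G' i = (if i \<le> degree G then w i else 0)" for i
      by (simp add: G'_def coeff_sum)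
    have GG': "G = smult b G'"
      by (rule poly_eqI) (simp add: coeff_G' w[symmetric] coeff_eq_0)
    have "b * (1 - w (degree G)) = 0"
      using w[of "degree G"] by (simp add: b_def right_diff_distrib)
    then have "w (degree G) = 1"
      using b0 lpoly_no_zero_divisors by fastforce
    moreover have "degree G' = degree G"
    proof (rule antisym)
      show "degree G' \<le> degree G"
        by (rule degree_le) (simp add: coeff_G')
      show "degree G \<le> degree G'"
        using \<open>w (degree G) = 1\<close> by (intro le_degree) (simp add: coeff_G')
    qed
    ultimately have monic': "lead_coeff G' = 1"
      by (simp add: coeff_G')
    have dvd: "G' dvd F" if F: "I F" for F
    proof -
      obtain N q where "smult (b ^ N) F = G * q"
        using multiple[OF F] by blast
      also have "G * q = G' * smult b q"
        by (subst GG') simp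
      finally have "G' dvd smult (b ^ N) F"
        by (rule dvdI)
      then show ?thesis
        by (rule monic_dvd_smult_cancel[OF monic' lpoly_power_nonzero[OF b0]])
    qed
    obtain Y where Y: "P = G' * Y"
      using dvd[OF IP] by blast
    \<comment> \<open>As a nonunit divisor of the irreducible \<open>P\<close>, \<open>G'\<close> is
      an associate of \<open>P\<close>; it also divides \<open>H\<close>, against
      \<open>ndvd\<close>.\<close>
    have "\<not> G' dvd 1"
      using monic_dvd_1[OF monic'] d \<open>degree G' = degree G\<close> by auto
    then have "Y dvd 1"
      using irr Y by (auto simp: irreducible_def)
    then obtain Z where "1 = Y * Z" by blast
    then have "G' = P * Z"
      using Y by (simp add: mult.assoc)
    then have "P dvd H"
      using dvd[OF IH] by (auto intro: dvd_trans)
    with ndvd show False ..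
  qed
  then obtain D where "G = [:D:]"
    by (metis degree_0_id)
  with G obtain U V where "U * P + V * H = [:D:]" "D \<noteq> 0"
    unfolding I_def by (metis pCons_0_0)
  then show ?thesis by blast
qed

text \<open>\<^const>\<open>pderiv\<close> requires a coefficient type without zero divisors, a sort that
  \<^typ>\<open>'d lpoly\<close> does not have.\<close>
definition formal_deriv :: "'a::comm_ring_1 poly \<Rightarrow> 'a poly" where
  "formal_deriv p = (\<Sum>i<degree p. monom (of_nat (Suc i) * coeff p (Suc i)) i)"

lemma coeff_formal_deriv: "coeff (formal_deriv p) i = of_nat (Suc i) * coeff p (Suc i)"
  by (auto simp: formal_deriv_def coeff_sum coeff_eq_0)

section \<open>Null sets of common roots and of multiple roots\<close>

definition at_torus :: "'d::finite lpolyl \<Rightarrow> real ^ 'd \<Rightarrow> complex poly" where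
  "at_torus P k = map_poly (\<lambda>p. eval_torus p k) (to_poly P)"

lemma at_torus_hom: "comm_ring_hom (\<lambda>P. at_torus P k)"
  unfolding at_torus_def by (rule comm_ring_hom_compose[OF eval_torus.map_poly_hom to_poly_hom])

interpretation at_torus: comm_ring_hom "\<lambda>P. at_torus P k" for k :: "real ^ 'd::finite"
  by (rule at_torus_hom)

text \<open>At a common root the Bezout identity evaluates to \<open>eval_torus D k = 0\<close>,
  because \<open>D\<close> is free of lambda.\<close>

lemma negligible_common_roots_poly:
  fixes P H :: "'d::finite lpoly poly"
  assumes "irreducible P" "lead_coeff P = 1" "\<not> P dvd H"
  shows "negligible {k. \<exists>x. poly (map_poly (\<lambda>p. eval_torus p k) P) x = 0 \<and>
                            poly (map_poly (\<lambda>p. eval_torus p k) H) x = 0}"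
proof -
  obtain U V D where D: "D \<noteq> 0" and eq: "U * P + V * H = [:D:]"
    using irreducible_bezout[OF assms] by blast
  have "eval_torus D k = 0" if "poly (map_poly (\<lambda>p. eval_torus p k) P) x = 0"
    "poly (map_poly (\<lambda>p. eval_torus p k) H) x = 0" for k x
  proof -
    interpret mp: comm_ring_hom "map_poly (\<lambda>p. eval_torus p k)"
      by (rule eval_torus.map_poly_hom)
    have "poly (map_poly (\<lambda>p. eval_torus p k) [:D:]) x = 0"
      unfolding eq[symmetric] by (simp add: mp.hom_add mp.hom_mult that)
    then show ?thesis
      by (simp add: map_poly_pCons eval_torus.hom_zero)
  qed
  then show ?thesis
    by (intro negligible_subset[OF negligible_zeros[OF D]]) auto
qed

text \<open>If \<open>P\<close> divided the irreducible \<open>H\<close>, the cofactor would be a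
  unit and monic, hence 1, against \<open>P \<noteq> H\<close>.\<close>

lemma negligible_common_roots:
  assumes "irreducible P" "lam_monic P" "irreducible H" "lam_monic H" "P \<noteq> H"
  shows "negligible {k. \<exists>x. poly (at_torus P k) x = 0 \<and> poly (at_torus H k) x = 0}"
  unfolding at_torus_def
proof (rule negligible_common_roots_poly)
  note monic = lead_coeff_to_poly[OF assms(2)] lead_coeff_to_poly[OF assms(4)]
  show "irreducible (to_poly P)"
    by (rule to_poly_irreducible[OF assms(1)])
  show "lead_coeff (to_poly P) = 1"
    by (rule monic(1))
  show "\<not> to_poly P dvd to_poly H"
  proof
    assume "to_poly P dvd to_poly H"
    then obtain Y where Y: "to_poly H = to_poly P * Y" by blast
    have "\<not> to_poly P dvd 1"
      using to_poly_irreducible[OF assms(1)] by (simp add: irreducible_def)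
    then have unit: "Y dvd 1"
      using to_poly_irreducible[OF assms(3)] Y by (auto simp: irreducible_def)
    then have "Y \<noteq> 0" by auto
    then have "lead_coeff Y = 1"
      using coeff_monic_mult[OF monic(1), of Y] degree_monic_mult[OF monic(1), of Y] monic(2)
      unfolding Y by simp
    then have "Y = 1"
      using unit by (rule monic_dvd_1)
    with Y assms(5) show False by simp
  qed
qed

lemma degree_pos_irreducible:
  assumes "irreducible P" "lam_monic P"
  shows "degree (to_poly P) > 0"
proof (rule ccontr)
  assume "\<not> degree (to_poly P) > 0"
  then have "to_poly P = 1"
    using lead_coeff_to_poly[OF assms(2)] by (metis degree_0_id not_gr_zero one_pCons)
  then show False
    using to_poly_irreducible[OF assms(1)] by (simp add: irreducible_def)
qed

lemma degree_at_torus: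
  assumes "lam_monic P"
  shows "degree (at_torus P k) = degree (to_poly P)" "lead_coeff (at_torus P k) = 1"
proof -
  show *: "degree (at_torus P k) = degree (to_poly P)"
    unfolding at_torus_def using lead_coeff_to_poly[OF assms]
    by (intro map_poly_degree_eq) (simp add: eval_torus.hom_one)
  show "lead_coeff (at_torus P k) = 1"
    unfolding * unfolding at_torus_def using lead_coeff_to_poly[OF assms] by (simp add: eval_torus.hom_one)
qed

text \<open>The lambda-derivative is nonzero and of smaller degree than the monic \<open>P\<close>,
  so \<open>P\<close> does not divide it.\<close>

lemma negligible_multiple_roots:
  assumes "irreducible P" "lam_monic P"
  shows "negligible {k. \<exists>x. poly (at_torus P k) x = 0 \<and> poly (pderiv (at_torus P k)) x = 0}"
proof -
  define p where "p = to_poly P"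
  have lead: "lead_coeff p = 1" and pos: "degree p > 0"
    unfolding p_def using lead_coeff_to_poly degree_pos_irreducible assms by blast+
  have "coeff (formal_deriv p) (degree p - 1) = of_nat (degree p)"
    using lead pos by (simp add: coeff_formal_deriv)
  \<comment> \<open>Evaluation at a point shows that the integer \<open>degree p\<close> is nonzero
    in the Laurent ring.\<close>
  moreover have "eval_torus (of_nat (degree p)) 0 \<noteq> 0"
    using pos by (simp add: eval_torus.hom_of_nat)
  ultimately have "formal_deriv p \<noteq> 0"
    by (metis coeff_0 eval_torus.hom_zero)
  moreover have "degree (formal_deriv p) < degree p"
  proof -
    have "degree (formal_deriv p) \<le> degree p - 1"
      by (rule degree_le) (auto simp: coeff_formal_deriv coeff_eq_0)
    with pos show ?thesis by simp
  qed
  ultimately have "\<not> p dvd formal_deriv p"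
    using monic_not_dvd_lower_degree[OF lead] by blast
  moreover have "irreducible p"
    unfolding p_def using assms(1) by (rule to_poly_irreducible)
  ultimately have "negligible {k. \<exists>x. poly (map_poly (\<lambda>p. eval_torus p k) p) x = 0 \<and>
      poly (map_poly (\<lambda>p. eval_torus p k) (formal_deriv p)) x = 0}"
    using lead by (intro negligible_common_roots_poly)
  moreover have "map_poly (\<lambda>p. eval_torus p k) (formal_deriv p) = pderiv (at_torus P k)" for k
  proof (rule poly_eqI)
    fix i
    show "coeff (map_poly (\<lambda>p. eval_torus p k) (formal_deriv p)) i = coeff (pderiv (at_torus P k)) i"
      by (simp add: coeff_formal_deriv coeff_pderiv at_torus_def p_def eval_torus.hom_mult
        eval_torus.hom_of_nat eval_torus.hom_add eval_torus.hom_one)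
  qed
  ultimately show ?thesis
    by (simp add: at_torus_def p_def)
qed

subsection \<open>Characteristic polynomials of Hermitian matrices\<close>

text \<open>Evaluation at \<open>k\<close> is a ring homomorphism and so commutes with
  \<open>det\<close>; this links the bands to the factors of \<open>PA A\<close>.\<close>

lemma charpoly_symb: "charpoly (symb A k) = at_torus (PA A) k"
proof -
  have embz: "at_torus (embz p) k = [:eval_torus p k:]" for p :: "'b lpoly"
    by (simp add: at_torus_def to_poly_embz map_poly_pCons eval_torus.hom_zero)
  have lam: "at_torus lam k = [:0, 1:]"
    by (simp add: at_torus_def to_poly_lam map_poly_pCons eval_torus.hom_zero eval_torus.hom_one)
  have "at_torus (if i = j then lam else 0) k = (if i = j then [:0, 1:] else 0)" for i j :: 'a
    by (simp add: lam at_torus.hom_zero)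
  then show ?thesis
    by (simp add: PA_def at_torus.hom_det charpoly_def symb_def at_torus.hom_diff embz)
qed

text \<open>In the Leibniz expansion a permutation contributes degree at most its number of fixed
  points, so only the identity reaches the top.\<close>

lemma degree_charpoly:
  fixes M :: "complex ^ 'q::finite ^ 'q"
  shows "degree (charpoly M) = CARD('q)" "lead_coeff (charpoly M) = (-1) ^ CARD('q)"
proof -
  define e where "e i j = [: M $ i $ j :] - (if i = j then [:0, 1:] else 0)" for i j
  have deg_e: "degree (e i j) \<le> (if i = j then 1 else 0)" for i j
    by (auto simp: e_def intro: degree_diff_le)
  define T where "T p = of_int (sign p) * (\<Prod>i\<in>UNIV. e i (p i))" for p :: "'q \<Rightarrow> 'q"
  have cp: "charpoly M = (\<Sum>p | p permutes UNIV. T p)"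
    by (simp add: charpoly_def det_def T_def e_def)
  have deg: "degree (\<Prod>i\<in>UNIV. e i (p i)) \<le> card {i. i = p i}" for p
  proof -
    have "degree (\<Prod>i\<in>UNIV. e i (p i)) \<le> (\<Sum>i\<in>UNIV. degree (e i (p i)))"
      using degree_prod_sum_le[of UNIV "\<lambda>i. e i (p i)"] by (simp add: o_def)
    also have "\<dots> \<le> (\<Sum>i\<in>UNIV. if i = p i then 1 else 0)"
      by (intro sum_mono deg_e)
    also have "\<dots> = card {i. i = p i}"
      by (simp add: sum.If_cases)
    finally show ?thesis .
  qed
  have degT: "degree (T p) \<le> card {i. i = p i}" for p
    using deg[of p] degree_mult_le[of "of_int (sign p)" "\<Prod>i\<in>UNIV. e i (p i)"]
    by (simp add: T_def)
  have T_id: "coeff (T id) CARD('q) = (-1) ^ CARD('q)"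
  proof -
    have e_id: "e i i = [: M $ i $ i, -1 :]" for i
      by (simp add: e_def)
    have "degree (\<Prod>i\<in>UNIV. e i i) = CARD('q)"
      by (subst degree_prod_eq_sum_degree) (simp_all add: e_id)
    moreover have "lead_coeff (\<Prod>i\<in>UNIV. e i i) = (-1) ^ CARD('q)"
      by (simp add: lead_coeff_prod e_id)
    ultimately show ?thesis
      by (simp add: T_def sign_id)
  qed
  have T_other: "coeff (T p) CARD('q) = 0" if p: "p \<noteq> id" for p
  proof -
    obtain i where "p i \<noteq> i"
      using p by (metis eq_id_iff)
    then have "i \<notin> {i. i = p i}"
      by simp
    then have "card {i. i = p i} < CARD('q)"
      by (intro psubset_card_mono) (blast intro: finite)+
    then show ?thesis
      using degT[of p] by (intro coeff_eq_0) simp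
  qed
  have "coeff (charpoly M) CARD('q) = (\<Sum>p :: 'q \<Rightarrow> 'q | p permutes UNIV. if p = id then (-1) ^ CARD('q) else 0)"
    unfolding cp coeff_sum by (intro sum.cong) (auto simp: T_id T_other)
  also have "\<dots> = (-1) ^ CARD('q)"
    by (simp add: permutes_id)
  finally have top: "coeff (charpoly M) CARD('q) = (-1) ^ CARD('q)" .
  show *: "degree (charpoly M) = CARD('q)"
  proof (rule antisym)
    have "card {i. i = p i} \<le> CARD('q)" for p :: "'q \<Rightarrow> 'q"
      by (intro card_mono) auto
    then show "degree (charpoly M) \<le> CARD('q)"
      unfolding cp using degT by (intro degree_sum_le) (auto intro: le_trans)
    show "CARD('q) \<le> degree (charpoly M)"
      using top by (intro le_degree) simp
  qed
  show "lead_coeff (charpoly M) = (-1) ^ CARD('q)"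
    using top by (simp add: *)
qed

lemma comm_ring_hom_poly: "comm_ring_hom (\<lambda>p. poly p x)"
  by unfold_locales auto

lemma charpoly_root_eigenvector:
  fixes M :: "complex ^ 'q::finite ^ 'q"
  assumes "poly (charpoly M) \<mu> = 0"
  shows "\<exists>x. x \<noteq> 0 \<and> M *v x = \<mu> *s x"
proof -
  define N where "N = M - mat \<mu>"
  have "poly (charpoly M) \<mu> = det N"
    unfolding charpoly_def comm_ring_hom.hom_det[OF comm_ring_hom_poly]
    by (rule arg_cong[of _ _ det]) (simp add: N_def vec_eq_iff mat_def)
  with assms have "\<not> invertible N"
    by (simp add: invertible_det_nz)
  then have "\<not> (\<exists>B. B ** N = mat 1)"
    by (simp only: invertible_left_inverse not_False_eq_True)
  then obtain x where "x \<noteq> 0" "N *v x = 0"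
    by (auto simp: matrix_left_invertible_ker)
  moreover from this have "M *v x = mat \<mu> *v x"
    by (simp add: N_def matrix_vector_mult_diff_rdistrib)
  moreover have "mat \<mu> *v x = \<mu> *s x"
    by (simp add: vec_eq_iff matrix_vector_mult_def mat_def if_distrib[of "\<lambda>y. y * _"] cong: if_cong)
  ultimately show ?thesis by metis
qed

text \<open>For an eigenvector \<open>x\<close> the Hermitian form \<open>s\<close> equals its own
  conjugate and is \<open>\<mu>\<close> times the positive real \<open>n\<close>.\<close>

lemma hermitian_charpoly_root_real:
  fixes M :: "complex ^ 'q::finite ^ 'q"
  assumes herm: "hermitian_mat M" and root: "poly (charpoly M) \<mu> = 0"
  shows "complex_of_real (Re \<mu>) = \<mu>"
proof -
  obtain x where x: "x \<noteq> 0" "M *v x = \<mu> *s x"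
    using charpoly_root_eigenvector[OF root] by blast
  define n where "n = (\<Sum>i\<in>UNIV. cnj (x $ i) * x $ i)"
  have n: "n = complex_of_real (\<Sum>i\<in>UNIV. (cmod (x $ i))\<^sup>2)"
    unfolding n_def of_real_sum complex_norm_square by (simp only: mult.commute)
  obtain i where "x $ i \<noteq> 0"
    using x(1) by (auto simp: vec_eq_iff)
  then have "0 < (\<Sum>i\<in>UNIV. (cmod (x $ i))\<^sup>2)"
    by (intro sum_pos2[of _ i]) auto
  then have "n \<noteq> 0"
    unfolding n by (metis of_real_eq_0_iff less_irrefl)
  define s where "s = (\<Sum>i\<in>UNIV. \<Sum>j\<in>UNIV. cnj (x $ i) * M $ i $ j * x $ j)"
  have "(\<Sum>j\<in>UNIV. M $ i $ j * x $ j) = \<mu> * x $ i" for i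
    using arg_cong[OF x(2), of "\<lambda>y. y $ i"] by (simp add: matrix_vector_mult_def)
  then have "s = (\<Sum>i\<in>UNIV. cnj (x $ i) * (\<mu> * x $ i))"
    unfolding s_def by (simp add: mult.assoc sum_distrib_left[symmetric])
  then have s: "s = \<mu> * n"
    by (simp add: n_def sum_distrib_left mult_ac)
  have M: "cnj (M $ i $ j) = M $ j $ i" for i j
    using herm unfolding hermitian_mat_def by (metis complex_cnj_cnj)
  have "cnj s = (\<Sum>i\<in>UNIV. \<Sum>j\<in>UNIV. cnj (x $ j) * M $ j $ i * x $ i)"
    unfolding s_def cnj_sum by (intro sum.cong refl) (simp add: M mult_ac)
  also have "\<dots> = s"
    unfolding s_def by (rule sum.swap)
  finally have "cnj \<mu> * n = \<mu> * n"
    unfolding s by (simp add: n)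
  with \<open>n \<noteq> 0\<close> have "cnj \<mu> = \<mu>"
    by simp
  then show ?thesis
    by (simp add: complex_eq_iff)
qed

section \<open>Root multiplicities and the ordered list of eigenvalues\<close>

lemma order_prod_list:
  fixes ps :: "'a::idom poly list"
  assumes "0 \<notin> set ps"
  shows "order x (prod_list ps) = (\<Sum>p\<leftarrow>ps. order x p)"
  using assms by (induction ps) (auto simp: order_mult prod_list_zero_iff)

lemma order_linear_factor: "order x [:a, -1 :: complex:] = (if x = a then 1 else 0)"
proof (cases "x = a")
  case True
  have "order x [:a, -1:] \<le> degree [:a, -1 :: complex:]"
    by (rule order_degree) simp
  moreover have "order x [:a, -1:] \<noteq> 0"
    using True order_root[of "[:a, -1:]" x] by auto
  ultimately show ?thesis
    using True by simp
next
  case False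
  then show ?thesis
    by (simp add: order_0I)
qed

lemma order_linear_factors:
  "order (complex_of_real x) (\<Prod>l\<leftarrow>ls. [: complex_of_real l, -1 :]) = count (mset ls) x"
proof -
  have "(0 :: complex poly) \<notin> set (map (\<lambda>l. [: complex_of_real l, -1 :]) ls)"
    by auto
  then have "order (complex_of_real x) (\<Prod>l\<leftarrow>ls. [: complex_of_real l, -1 :])
      = (\<Sum>l\<leftarrow>ls. order (complex_of_real x) [: complex_of_real l, -1 :])"
    by (simp add: order_prod_list o_def)
  also have "\<dots> = count (mset ls) x"
    by (induction ls) (auto simp: order_linear_factor)
  finally show ?thesis .
qed

text \<open>This justifies the definite description in \<open>bands\<close>. Existence: the charpoly
  splits with real roots. Uniqueness: root orders fix the multiset, and sorting fixes the
  list.\<close>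

lemma bands_unique:
  fixes M :: "complex ^ 'q::finite ^ 'q"
  assumes herm: "hermitian_mat M"
  shows "\<exists>!ls. length ls = CARD('q) \<and> sorted ls \<and> charpoly M = (\<Prod>l\<leftarrow>ls. [: complex_of_real l, -1 :])"
proof (rule ex_ex1I)
  have "charpoly M \<noteq> 0"
    using degree_charpoly(2)[of M] by auto
  then obtain A where A: "size A = degree (charpoly M)"
    "charpoly M = smult (lead_coeff (charpoly M)) (\<Prod>x\<in>#A. [:-x, 1:])"
    using alg_closed_imp_factorization by blast
  have real: "complex_of_real (Re x) = x" if "x \<in># A" for x
  proof (rule hermitian_charpoly_root_real[OF herm])
    show "poly (charpoly M) x = 0"
      using that by (subst A(2)) (auto simp: poly_prod_mset prod_mset_zero_iff)
  qed
  have lc: "lead_coeff (charpoly M) = (-1) ^ size A"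
    using degree_charpoly(2)[of M] by (simp add: A(1) degree_charpoly(1))
  define ls where "ls = sorted_list_of_multiset (image_mset Re A)"
  have "(\<Prod>l\<leftarrow>ls. [: complex_of_real l, -1 :]) = (\<Prod>l\<in>#image_mset Re A. [: complex_of_real l, -1 :])"
    unfolding prod_mset_prod_list[symmetric] by (simp add: ls_def)
  also have "\<dots> = (\<Prod>x\<in>#A. [: x, -1 :])"
    unfolding image_mset.compositionality by (intro arg_cong[of _ _ prod_mset] image_mset_cong) (simp add: real)
  \<comment> \<open>Each factor is minus a monic one; the signs collect to the leading coefficient
    of \<open>charpoly M\<close>.\<close>
  also have "\<dots> = smult ((-1) ^ size A) (\<Prod>x\<in>#A. [:-x, 1:])"
    by (induction A) (simp_all add: smult_add_right smult_diff_right)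
  also have "\<dots> = charpoly M"
    by (subst A(2)) (simp only: lc)
  finally have "charpoly M = (\<Prod>l\<leftarrow>ls. [: complex_of_real l, -1 :])" ..
  moreover have "length ls = CARD('q)"
    by (simp add: ls_def A(1) degree_charpoly(1) flip: size_mset)
  moreover have "sorted ls"
    by (simp add: ls_def)
  ultimately show "\<exists>ls. length ls = CARD('q) \<and> sorted ls \<and> charpoly M = (\<Prod>l\<leftarrow>ls. [: complex_of_real l, -1 :])"
    by blast
next
  fix ls ls'
  assume ls: "length ls = CARD('q) \<and> sorted ls \<and> charpoly M = (\<Prod>l\<leftarrow>ls. [: complex_of_real l, -1 :])"
    and ls': "length ls' = CARD('q) \<and> sorted ls' \<and> charpoly M = (\<Prod>l\<leftarrow>ls'. [: complex_of_real l, -1 :])"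
  have "mset ls = mset ls'"
    by (rule multiset_eqI) (metis ls ls' order_linear_factors)
  then show "ls = ls'"
    using ls ls' by (metis properties_for_sort)
qed

lemma bands:
  fixes M :: "complex ^ 'q::finite ^ 'q"
  assumes "hermitian_mat M"
  shows "length (bands M) = CARD('q)" "charpoly M = (\<Prod>l\<leftarrow>bands M. [: complex_of_real l, -1 :])"
  using theI'[OF bands_unique[OF assms]] unfolding bands_def by blast+

lemma charpoly_root_iff_band:
  fixes M :: "complex ^ 'q::finite ^ 'q"
  assumes "hermitian_mat M"
  shows "poly (charpoly M) \<mu> = 0 \<longleftrightarrow> (\<exists>s<CARD('q). \<mu> = complex_of_real (bands M ! s))"
proof -
  have "poly (charpoly M) \<mu> = 0 \<longleftrightarrow> (\<exists>l\<in>set (bands M). \<mu> = complex_of_real l)"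
    by (subst bands(2)[OF assms]) (auto simp: comm_ring_hom.hom_prod_list[OF comm_ring_hom_poly] prod_list_zero_iff)
  then show ?thesis
    by (metis bands(1)[OF assms] in_set_conv_nth)
qed

lemma repeated_band_iff:
  fixes M :: "complex ^ 'q::finite ^ 'q"
  assumes "hermitian_mat M"
  shows "(\<exists>s<CARD('q). \<exists>w<CARD('q). s \<noteq> w \<and> bands M ! s = bands M ! w)
    \<longleftrightarrow> (\<exists>x. 2 \<le> order x (charpoly M))"
proof -
  have "(\<exists>s<CARD('q). \<exists>w<CARD('q). s \<noteq> w \<and> bands M ! s = bands M ! w) \<longleftrightarrow> \<not> distinct (bands M)"
    using bands(1)[OF assms] by (auto simp: distinct_conv_nth)
  also have "\<dots> \<longleftrightarrow> (\<exists>l. 2 \<le> count (mset (bands M)) l)"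
    unfolding distinct_count_atmost_1
    by (metis Suc_1 Suc_leI count_mset_0_iff leD le_less_linear less_one not_less_eq_eq order_le_less order_less_irrefl)
  also have "\<dots> \<longleftrightarrow> (\<exists>l. 2 \<le> order (complex_of_real l) (charpoly M))"
    by (subst bands(2)[OF assms]) (simp add: order_linear_factors)
  also have "\<dots> \<longleftrightarrow> (\<exists>x. 2 \<le> order x (charpoly M))"
  proof
    assume "\<exists>x. 2 \<le> order x (charpoly M)"
    then obtain x where x: "2 \<le> order x (charpoly M)" by blast
    then have "poly (charpoly M) x = 0"
      by (metis not_numeral_le_zero order_0I)
    then have "complex_of_real (Re x) = x"
      by (rule hermitian_charpoly_root_real[OF assms])
    with x show "\<exists>l. 2 \<le> order (complex_of_real l) (charpoly M)"
      by metis
  qed auto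
  finally show ?thesis .
qed

lemma order_ge_2:
  fixes p :: "complex poly"
  assumes "p \<noteq> 0" "2 \<le> order x p"
  shows "poly p x = 0" "poly (pderiv p) x = 0"
proof -
  define l where "l = [:-x, 1:]"
  have "l ^ 2 dvd p"
    using assms by (simp add: l_def order_divides)
  then obtain q where q: "p = l ^ 2 * q" by blast
  have "poly l x = 0"
    by (simp add: l_def)
  then show "poly p x = 0" "poly (pderiv p) x = 0"
    unfolding q by (simp_all add: power2_eq_square pderiv_mult)
qed

text \<open>Splits a multiple root of a product: it is multiple in one factor or shared by
  two.\<close>

lemma sum_ge_2:
  fixes f :: "'a \<Rightarrow> nat"
  assumes "finite I" "2 \<le> sum f I"
  shows "(\<exists>i\<in>I. 2 \<le> f i) \<or> (\<exists>i\<in>I. \<exists>j\<in>I. i \<noteq> j \<and> 1 \<le> f i \<and> 1 \<le> f j)"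
proof (rule ccontr)
  assume neg: "\<not> ?thesis"
  obtain i where i: "i \<in> I" "f i \<noteq> 0"
    using assms(2) by (metis not_numeral_le_zero sum.neutral)
  have "sum f (I - {i}) = 0"
  proof (intro sum.neutral ballI, rule ccontr)
    fix j assume "j \<in> I - {i}" "f j \<noteq> 0"
    then have "j \<in> I" "i \<noteq> j" "1 \<le> f j" "1 \<le> f i"
      using i by auto
    with neg i(1) show False by blast
  qed
  then have "sum f I = f i"
    using sum.remove[OF assms(1) i(1), of f] by simp
  with neg i assms(2) show False by auto
qed

section \<open>Band coincidences as common roots of the irreducible factors\<close>

theorem theorem1:
  fixes A :: "'q::finite \<Rightarrow> 'q \<Rightarrow> 'd::finite lpoly"
    and Ps :: "'d lpolyl list"
    and \<alpha> :: "real ^ 'd"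
  assumes herm: "\<And>k. hermitian_mat (symb A k)"
    and irred: "\<And>P. P \<in> set Ps \<Longrightarrow> irreducible P"
    and monic: "\<And>P. P \<in> set Ps \<Longrightarrow> lam_monic P"
    and fact: "PA A = (-1) ^ CARD('q) * prod_list Ps"
    and alpha: "\<exists>j. \<alpha> $ j \<notin> \<int>"
  shows "(cond_C \<alpha> Ps \<longleftrightarrow>
            {k. \<exists>s<CARD('q). \<exists>w<CARD('q). band A s (k + \<alpha>) = band A w k}
              \<in> null_sets lebesgue)
       \<and> (square_free_factors Ps \<longleftrightarrow>
            {k. \<exists>s<CARD('q). \<exists>w<CARD('q). s \<noteq> w \<and> band A s k = band A w k}
              \<in> null_sets lebesgue)"
proof -
  define S1 where "S1 = {k. \<exists>s<CARD('q). \<exists>w<CARD('q). band A s (k + \<alpha>) = band A w k}"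
  define S2 where "S2 = {k. \<exists>s<CARD('q). \<exists>w<CARD('q). s \<noteq> w \<and> band A s k = band A w k}"
  have shift: "at_torus (shiftz \<alpha> P) k = at_torus P (k + \<alpha>)" for P k
    unfolding at_torus_def by (rule map_poly_shiftz)
  \<comment> \<open>Each factor stays monic of positive degree in lambda at every
    \<open>k\<close>.\<close>
  have nz: "at_torus P k \<noteq> 0" and root: "\<exists>x. poly (at_torus P k) x = 0" if "P \<in> set Ps" for P k
  proof -
    show "at_torus P k \<noteq> 0"
      using degree_at_torus(2)[OF monic[OF that], of k] by auto
    have "degree (at_torus P k) > 0"
      using degree_at_torus(1)[OF monic[OF that], of k] degree_pos_irreducible[OF irred monic] that by simp
    then show "\<exists>x. poly (at_torus P k) x = 0"
      by (intro alg_closed_imp_poly_has_root)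
  qed
  have cp: "charpoly (symb A k) = smult ((-1) ^ CARD('q)) (prod_list (map (\<lambda>P. at_torus P k) Ps))" for k
  proof -
    have "(-1) ^ n * p = smult ((-1) ^ n) p" for n and p :: "complex poly"
      by (induction n) auto
    then show ?thesis
      by (simp add: charpoly_symb fact at_torus.hom_mult at_torus.hom_power at_torus.hom_uminus at_torus.hom_one at_torus.hom_prod_list)
  qed
  have cp_root: "poly (charpoly (symb A k)) x = 0 \<longleftrightarrow> (\<exists>i<length Ps. poly (at_torus (Ps ! i) k) x = 0)" for k x
    unfolding cp by (simp add: comm_ring_hom.hom_prod_list[OF comm_ring_hom_poly] prod_list_zero_iff
      image_iff eq_commute[of 0]) (metis in_set_conv_nth)
  have cp_order: "order x (charpoly (symb A k)) = (\<Sum>i<length Ps. order x (at_torus (Ps ! i) k))" for k x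
  proof -
    have "0 \<notin> set (map (\<lambda>P. at_torus P k) Ps)"
      using nz by auto
    then show ?thesis
      unfolding cp by (simp add: order_smult order_prod_list sum_list_sum_nth atLeast0LessThan)
  qed
  \<comment> \<open>The bands are exactly the roots of the charpoly, so a coincidence is a common
    root of the charpolys at \<open>k\<close> and \<open>k + \<alpha>\<close>.\<close>
  have S1: "k \<in> S1 \<longleftrightarrow> (\<exists>x. \<exists>i<length Ps. \<exists>j<length Ps.
      poly (at_torus (Ps ! i) k) x = 0 \<and> poly (at_torus (shiftz \<alpha> (Ps ! j)) k) x = 0)" for k
  proof -
    have "k \<in> S1 \<longleftrightarrow> (\<exists>x. poly (charpoly (symb A k)) x = 0 \<and> poly (charpoly (symb A (k + \<alpha>))) x = 0)"
      unfolding charpoly_root_iff_band[OF herm] S1_def band_def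
      by (auto simp: of_real_eq_iff) (metis of_real_eq_iff)+
    then show ?thesis
      unfolding cp_root shift by blast
  qed
  have S2: "k \<in> S2 \<longleftrightarrow> (\<exists>x. 2 \<le> (\<Sum>i<length Ps. order x (at_torus (Ps ! i) k)))" for k
    using repeated_band_iff[OF herm[of k]] by (simp add: S2_def band_def cp_order)
  have "cond_C \<alpha> Ps \<longleftrightarrow> negligible S1"
  proof
    assume C: "cond_C \<alpha> Ps"
    have "negligible (\<Union>i<length Ps. \<Union>j<length Ps.
        {k. \<exists>x. poly (at_torus (Ps ! i) k) x = 0 \<and> poly (at_torus (shiftz \<alpha> (Ps ! j)) k) x = 0})"
    proof (intro negligible_Union finite_imageI finite_lessThan ballI, elim imageE, hypsubst,
        intro negligible_Union finite_imageI finite_lessThan ballI, elim imageE, hypsubst)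
      fix i j assume "i \<in> {..<length Ps}" "j \<in> {..<length Ps}"
      then have "Ps ! i \<in> set Ps" "Ps ! j \<in> set Ps" "Ps ! i \<noteq> shiftz \<alpha> (Ps ! j)"
        using C by (auto simp: cond_C_def)
      then show "negligible {k. \<exists>x. poly (at_torus (Ps ! i) k) x = 0 \<and> poly (at_torus (shiftz \<alpha> (Ps ! j)) k) x = 0}"
        by (intro negligible_common_roots irred monic shiftz_irreducible shiftz_monic)
    qed
    then show "negligible S1"
    proof (rule negligible_subset, intro subsetI)
      fix k assume "k \<in> S1"
      then obtain x i j where "i < length Ps" "j < length Ps"
        "poly (at_torus (Ps ! i) k) x = 0" "poly (at_torus (shiftz \<alpha> (Ps ! j)) k) x = 0"
        unfolding S1 by blast
      then show "k \<in> (\<Union>i<length Ps. \<Union>j<length Ps.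
          {k. \<exists>x. poly (at_torus (Ps ! i) k) x = 0 \<and> poly (at_torus (shiftz \<alpha> (Ps ! j)) k) x = 0})"
        by blast
    qed
  next
    assume neg: "negligible S1"
    show "cond_C \<alpha> Ps"
      unfolding cond_C_def
    proof (intro allI impI notI)
      fix i j assume ij: "i < length Ps" "j < length Ps" "Ps ! i = shiftz \<alpha> (Ps ! j)"
      \<comment> \<open>Equal factors share a root at every \<open>k\<close>.\<close>
      have "S1 = UNIV"
        using root[of "Ps ! i"] ij by (auto simp: S1) (metis nth_mem)
      with neg show False by simp
    qed
  qed
  moreover have "square_free_factors Ps \<longleftrightarrow> negligible S2"
  proof
    assume sf: "square_free_factors Ps"
    \<comment> \<open>On the diagonal a multiple root is a common root with the derivative.\<close>
    let ?B = "\<lambda>i j. {k. \<exists>x. poly (at_torus (Ps ! i) k) x = 0 \<and>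
        poly (if i = j then pderiv (at_torus (Ps ! i) k) else at_torus (Ps ! j) k) x = 0}"
    have "negligible (\<Union>i<length Ps. \<Union>j<length Ps. ?B i j)"
    proof (intro negligible_Union finite_imageI finite_lessThan ballI, elim imageE, hypsubst,
        intro negligible_Union finite_imageI finite_lessThan ballI, elim imageE, hypsubst)
      fix i j assume ij: "i \<in> {..<length Ps}" "j \<in> {..<length Ps}"
      then have Ps: "Ps ! i \<in> set Ps" "Ps ! j \<in> set Ps" "i \<noteq> j \<Longrightarrow> Ps ! i \<noteq> Ps ! j"
        using sf by (auto simp: square_free_factors_def)
      show "negligible (?B i j)"
      proof (cases "i = j")
        case True
        then show ?thesis
          using negligible_multiple_roots[OF irred monic] Ps(1) by simp
      next
        case False
        then show ?thesis
          using negligible_common_roots[OF irred monic irred monic] Ps by simp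
      qed
    qed
    moreover have "k \<in> (\<Union>i<length Ps. \<Union>j<length Ps. ?B i j)" if k: "k \<in> S2" for k
    proof -
      obtain x where "2 \<le> (\<Sum>i<length Ps. order x (at_torus (Ps ! i) k))"
        using k unfolding S2 by blast
      then consider i where "i < length Ps" "2 \<le> order x (at_torus (Ps ! i) k)"
        | i j where "i < length Ps" "j < length Ps" "i \<noteq> j"
            "1 \<le> order x (at_torus (Ps ! i) k)" "1 \<le> order x (at_torus (Ps ! j) k)"
        using sum_ge_2[of "{..<length Ps}" "\<lambda>i. order x (at_torus (Ps ! i) k)"] by auto
      then show ?thesis
      proof cases
        case 1
        then have "k \<in> ?B i i"
          using order_ge_2[OF nz[of "Ps ! i" k], of x] by auto
        with 1 show ?thesis by blast
      next
        case 2
        then have "poly (at_torus (Ps ! i) k) x = 0" "poly (at_torus (Ps ! j) k) x = 0"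
          by (auto simp: order_root)
        with 2 have "k \<in> ?B i j"
          by auto
        with 2 show ?thesis by blast
      qed
    qed
    ultimately show "negligible S2"
      by (meson negligible_subset subsetI)
  next
    assume neg: "negligible S2"
    show "square_free_factors Ps"
      unfolding square_free_factors_def
    proof (intro allI impI notI)
      fix i j assume ij: "i < length Ps" "j < length Ps" "i \<noteq> j" "Ps ! i = Ps ! j"
      have "k \<in> S2" for k
      proof -
        obtain x where "poly (at_torus (Ps ! i) k) x = 0"
          using root[of "Ps ! i" k] ij by auto
        then have "1 \<le> order x (at_torus (Ps ! i) k)" "1 \<le> order x (at_torus (Ps ! j) k)"
          using nz[of "Ps ! i" k] ij by (auto simp: order_root Suc_le_eq)
        \<comment> \<open>Two equal factors at different positions each add at least 1 to the order
          of the same root.\<close>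
        then have "2 \<le> (\<Sum>l\<in>{i, j}. order x (at_torus (Ps ! l) k))"
          using ij by simp
        also have "\<dots> \<le> (\<Sum>l<length Ps. order x (at_torus (Ps ! l) k))"
          using ij by (intro sum_mono2) auto
        finally show ?thesis
          unfolding S2 by blast
      qed
      then have "S2 = UNIV" by blast
      with neg show False by simp
    qed
  qed
  ultimately show ?thesis
    by (simp add: S1_def S2_def negligible_iff_null_sets)
qed

end
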